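(* Let $n\ge 3$, $N=\{1,2,\dots,n\}$, and let $A=[a_{ij}]$ be an $n\times n$ zero-diagonal symmetric integer matrix. If $A$ satisfies that for any subset $S$ of $N$ with $1<|S|<n$, $a_{kl}\ne a_{kl'}$ for any $k\in N\setminus S$ and any distinct $l,l'\in S$, then $A$ is the crossing matrix of a pseudo-Anosov pure $n$-braid. In particular, if $a_{kl}\neq a_{kl'}$ for any $k\in N$ and any distinct $l,l'\in N$, then $A$ is the crossing matrix of a pseudo-Anosov pure $n$-braid.
   Context: $\mathcal{B}_n$ denotes the braid group on $n$ strands; an $n$-braid has $n$ strands running monotonically from an upper bar to a lower bar, and the product $bb'$ is $b$ placed above $b'$. The $i$-th strand is the one whose upper endpoint is in the $i$-th position from the left. A braid is pure if for every $i$ the $i$-th strand ends at the $i$-th position of the lower bar. In $\sigma_i$ the strands in positions $i$ and $i+1$ cross once, the strand going from position $i+1$ to position $i$ passing over; this crossing has sign $+1$. In $\sigma_i^{-1}$ the strand going from position $i$ to position $i+1$ passes over, and the crossing has sign $-1$. The crossing matrix $C(b)=[m_{ij}]$ of an $n$-braid $b$ is the $n\times n$ integer matrix with $m_{ii}=0$ and, for $i\ne j$, $m_{ij}$ equal to the sum of the signs of the crossings, in a diagram of $b$, at which the $i$-th strand is over the $j$-th strand. It does not depend on the diagram. Pseudo-Anosov is meant in the Nielsen–Thurston sense, an $n$-braid being regarded as a mapping class of the $n$-punctured disk: every braid is periodic, reducible or pseudo-Anosov, and the pseudo-Anosov braids are exactly those that are neither periodic (some positive power is a power of the full twist) nor reducible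 (preserving, up to isotopy, a nonempty family of pairwise disjoint simple closed curves each enclosing at least $2$ and at most $n-1$ punctures). *)

theory Defs
  imports "HOL-Analysis.Analysis" "HOL-Algebra.Group"
begin

section \<open>Braid words and the braid group\<close>

text \<open>
  A braid word is read from the upper bar to the lower bar; it is the same thing as a braid diagram
  whose crossings occur at different heights.  The letter \<open>(i, True)\<close> is $\sigma_i$ and
  \<open>(i, False)\<close> is $\sigma_i^{-1}$, with $1 \le i < n$.
\<close>

type_synonym braid_word = "(nat \<times> bool) list"

definition braid_words :: "nat \<Rightarrow> braid_word set" where
  "braid_words n = lists ({1..<n} \<times> UNIV)"

text \<open>The congruence on words that is generated by Artin's relations:\<close>

inductive braid_eq :: "nat \<Rightarrow> braid_word \<Rightarrow> braid_word \<Rightarrow> bool" for n where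
  refl: "w \<in> braid_words n \<Longrightarrow> braid_eq n w w"
| sym: "braid_eq n u v \<Longrightarrow> braid_eq n v u"
| trans: "braid_eq n u v \<Longrightarrow> braid_eq n v w \<Longrightarrow> braid_eq n u w"
| cong: "braid_eq n u u' \<Longrightarrow> braid_eq n v v' \<Longrightarrow> braid_eq n (u @ v) (u' @ v')"
| cancel: "i \<in> {1..<n} \<Longrightarrow> braid_eq n [(i, e), (i, \<not> e)] []"
| far: "i \<in> {1..<n} \<Longrightarrow> j \<in> {1..<n} \<Longrightarrow> i + 2 \<le> j \<Longrightarrow>
    braid_eq n [(i, True), (j, True)] [(j, True), (i, True)]"
| braid: "i \<in> {1..<n} \<Longrightarrow> Suc i \<in> {1..<n} \<Longrightarrow>
    braid_eq n [(i, True), (Suc i, True), (i, True)] [(Suc i, True), (i, True), (Suc i, True)]"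

definition braid_rel :: "nat \<Rightarrow> (braid_word \<times> braid_word) set" where
  "braid_rel n = {(u, v). braid_eq n u v}"

definition braid_group :: "nat \<Rightarrow> braid_word set monoid" where
  "braid_group n =
    \<lparr>carrier = braid_words n // braid_rel n,
     mult = (\<lambda>b c. \<Union>u\<in>b. \<Union>v\<in>c. braid_rel n `` {u @ v}),
     one = braid_rel n `` {[]}\<rparr>"

text \<open>The full twist $(\sigma_1 \sigma_2 \cdots \sigma_{n-1})^n$:\<close>

definition full_twist :: "nat \<Rightarrow> braid_word set" where
  "full_twist n = braid_rel n `` {concat (replicate n (map (\<lambda>i. (i, True)) [1..<n]))}"

lemma braid_words_append [simp]:
  "u @ v \<in> braid_words n \<longleftrightarrow> u \<in> braid_words n \<and> v \<in> braid_words n"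
  by (auto simp: braid_words_def)

lemma braid_eq_words: "braid_eq n u v \<Longrightarrow> u \<in> braid_words n \<and> v \<in> braid_words n"
  by (induction rule: braid_eq.induct) (auto simp: braid_words_def)

lemma equiv_braid_rel: "equiv (braid_words n) (braid_rel n)"
  by (rule equivI)
     (auto simp: braid_rel_def refl_on_def sym_def trans_def dest: braid_eq_words
           intro: braid_eq.refl braid_eq.sym braid_eq.trans)

lemma braid_class_eq_iff:
  assumes "u \<in> braid_words n" "v \<in> braid_words n"
  shows "braid_rel n `` {u} = braid_rel n `` {v} \<longleftrightarrow> braid_eq n u v"
  using eq_equiv_class_iff[OF equiv_braid_rel assms] by (simp add: braid_rel_def)

lemma braid_group_cases:
  assumes "b \<in> carrier (braid_group n)"
  obtains w where "w \<in> braid_words n" "b = braid_rel n `` {w}"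
  using assms by (auto simp: braid_group_def elim: quotientE)

lemma braid_class_in_carrier [simp]:
  "w \<in> braid_words n \<Longrightarrow> braid_rel n `` {w} \<in> carrier (braid_group n)"
  by (simp add: braid_group_def quotientI)

lemma full_twist_in_carrier: "full_twist n \<in> carrier (braid_group n)"
  unfolding full_twist_def
  by (rule braid_class_in_carrier) (auto simp: braid_words_def in_lists_conv_set)

lemma one_braid_group: "\<one>\<^bsub>braid_group n\<^esub> = braid_rel n `` {[]}"
  by (simp add: braid_group_def)

lemma mult_braid_class:
  assumes "u \<in> braid_words n" "v \<in> braid_words n"
  shows "braid_rel n `` {u} \<otimes>\<^bsub>braid_group n\<^esub> braid_rel n `` {v} = braid_rel n `` {u @ v}"
proof -
  have "braid_rel n `` {u' @ v'} = braid_rel n `` {u @ v}"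
    if "u' \<in> braid_rel n `` {u}" "v' \<in> braid_rel n `` {v}" for u' v'
  proof -
    have "braid_eq n (u @ v) (u' @ v')"
      using that by (intro braid_eq.cong) (simp_all add: braid_rel_def)
    then show ?thesis
      using braid_eq_words[of n "u @ v" "u' @ v'"] braid_class_eq_iff by metis
  qed
  moreover have "u \<in> braid_rel n `` {u}" "v \<in> braid_rel n `` {v}"
    using assms by (auto simp: braid_rel_def intro: braid_eq.refl)
  ultimately have "(\<Union>u'\<in>braid_rel n `` {u}. \<Union>v'\<in>braid_rel n `` {v}. braid_rel n `` {u' @ v'})
      = braid_rel n `` {u @ v}"
    by blast
  then show ?thesis by (simp add: braid_group_def)
qed

lemma braid_word_inverse:
  "w \<in> braid_words n \<Longrightarrow> \<exists>v \<in> braid_words n. braid_eq n (v @ w) []"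
proof (induction w)
  case Nil
  then show ?case by (auto intro!: bexI[of _ "[]"] braid_eq.refl)
next
  case (Cons x w)
  obtain i e where x: "x = (i, e)" by force
  have i: "i \<in> {1..<n}" and w: "w \<in> braid_words n"
    using Cons.prems by (auto simp: braid_words_def x)
  obtain v where v: "v \<in> braid_words n" "braid_eq n (v @ w) []"
    using Cons.IH w by blast
  have c: "braid_eq n [(i, \<not> e), (i, e)] []"
    using braid_eq.cancel[OF i, of "\<not> e"] by simp
  have "braid_eq n (v @ [(i, \<not> e), (i, e)] @ w) (v @ [] @ w)"
    using v w c by (intro braid_eq.cong braid_eq.refl) auto
  then have "braid_eq n ((v @ [(i, \<not> e)]) @ x # w) []"
    using v braid_eq.trans by (fastforce simp: x)
  moreover have "v @ [(i, \<not> e)] \<in> braid_words n"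
    using v i by (auto simp: braid_words_def)
  ultimately show ?case by blast
qed

lemma group_braid_group: "group (braid_group n)"
proof (rule groupI)
  show "\<one>\<^bsub>braid_group n\<^esub> \<in> carrier (braid_group n)"
    unfolding one_braid_group by (rule braid_class_in_carrier) (simp add: braid_words_def)
next
  fix b c assume "b \<in> carrier (braid_group n)" "c \<in> carrier (braid_group n)"
  then show "b \<otimes>\<^bsub>braid_group n\<^esub> c \<in> carrier (braid_group n)"
    by (auto elim!: braid_group_cases simp: mult_braid_class)
next
  fix b c d
  assume "b \<in> carrier (braid_group n)" "c \<in> carrier (braid_group n)" "d \<in> carrier (braid_group n)"
  then show "b \<otimes>\<^bsub>braid_group n\<^esub> c \<otimes>\<^bsub>braid_group n\<^esub> d =
      b \<otimes>\<^bsub>braid_group n\<^esub> (c \<otimes>\<^bsub>braid_group n\<^esub> d)"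
    by (auto elim!: braid_group_cases simp: mult_braid_class)
next
  fix b assume "b \<in> carrier (braid_group n)"
  then obtain w where w: "w \<in> braid_words n" "b = braid_rel n `` {w}"
    by (rule braid_group_cases)
  have e: "[] \<in> braid_words n" by (simp add: braid_words_def)
  show "\<one>\<^bsub>braid_group n\<^esub> \<otimes>\<^bsub>braid_group n\<^esub> b = b"
    using mult_braid_class[OF e w(1)] by (simp add: one_braid_group w)
  obtain v where "v \<in> braid_words n" "braid_eq n (v @ w) []"
    using braid_word_inverse w by blast
  then show "\<exists>c\<in>carrier (braid_group n). c \<otimes>\<^bsub>braid_group n\<^esub> b = \<one>\<^bsub>braid_group n\<^esub>"
    using w e
    by (intro bexI[of _ "braid_rel n `` {v}"])
       (auto simp: one_braid_group mult_braid_class braid_class_eq_iff)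
qed


section \<open>Strands, pure braids and the crossing matrix\<close>

text \<open>\<open>strand_at w p\<close> is the strand in position \<open>p\<close> below all the crossings of \<open>w\<close>.\<close>

definition strand_at :: "braid_word \<Rightarrow> nat \<Rightarrow> nat" where
  "strand_at w = fold (\<lambda>(i, e) s. s \<circ> Transposition.transpose i (Suc i)) w id"

text \<open>
  The over strand and the under strand at the crossing \<open>w ! t\<close>, named by their upper endpoints:
  the over strand comes from position $i + 1$ in $\sigma_i$ and from position $i$ in
  $\sigma_i^{-1}$.
\<close>

definition over_strand :: "braid_word \<Rightarrow> nat \<Rightarrow> nat" where
  "over_strand w t =
    (case w ! t of (i, e) \<Rightarrow> strand_at (take t w) (if e then Suc i else i))"

definition under_strand :: "braid_word \<Rightarrow> nat \<Rightarrow> nat" where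
  "under_strand w t =
    (case w ! t of (i, e) \<Rightarrow> strand_at (take t w) (if e then i else Suc i))"

definition crossing_sign :: "nat \<times> bool \<Rightarrow> int" where
  "crossing_sign x = (if snd x then 1 else -1)"

definition word_crossing_matrix :: "braid_word \<Rightarrow> nat \<Rightarrow> nat \<Rightarrow> int" where
  "word_crossing_matrix w i j =
    (\<Sum>t | t < length w \<and> over_strand w t = i \<and> under_strand w t = j. crossing_sign (w ! t))"

text \<open>
  The entries of the crossing matrix of a braid, for indices in \<open>{1..n}\<close>.  All the words that
  represent the braid give the same value.
\<close>

definition crossing_matrix :: "braid_word set \<Rightarrow> nat \<Rightarrow> nat \<Rightarrow> int" where
  "crossing_matrix b i j = the_elem ((\<lambda>w. word_crossing_matrix w i j) ` b)"

definition pure_braid :: "nat \<Rightarrow> braid_word set \<Rightarrow> bool" where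
  "pure_braid n b \<longleftrightarrow> (\<forall>w\<in>b. \<forall>p\<in>{1..n}. strand_at w p = p)"

lemma strand_at_Nil [simp]: "strand_at [] = id"
  by (simp add: strand_at_def)

lemma strand_at_snoc: "strand_at (w @ [(i, e)]) = strand_at w \<circ> Transposition.transpose i (Suc i)"
  by (simp add: strand_at_def)

lemma strand_at_append: "strand_at (u @ v) = strand_at u \<circ> strand_at v"
proof (induction v rule: rev_induct)
  case (snoc x v)
  then show ?case
    by (cases x) (simp only: append_assoc[symmetric] strand_at_snoc, simp add: comp_assoc)
qed simp

lemma bij_strand_at: "bij (strand_at w)"
proof (induction w rule: rev_induct)
  case Nil
  show ?case by (simp only: strand_at_Nil bij_id)
next
  case (snoc x w)
  obtain i e where "x = (i, e)" by force
  then show ?case using bij_comp[OF bij_transpose snoc.IH] by (simp only: strand_at_snoc)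
qed

lemmas inj_strand_at = bij_is_inj[OF bij_strand_at]
  and surj_strand_at = bij_is_surj[OF bij_strand_at]

lemma word_crossing_matrix_alt:
  "word_crossing_matrix w i j =
    (\<Sum>t<length w. if over_strand w t = i \<and> under_strand w t = j then crossing_sign (w ! t) else 0)"
proof -
  have "{t. t < length w \<and> over_strand w t = i \<and> under_strand w t = j} =
      {t \<in> {..<length w}. over_strand w t = i \<and> under_strand w t = j}"
    by auto
  then show ?thesis
    unfolding word_crossing_matrix_def by (simp only: sum.inter_filter finite_lessThan)
qed

lemma word_crossing_matrix_append:
  "word_crossing_matrix (u @ v) (strand_at u i) (strand_at u j) =
    word_crossing_matrix u (strand_at u i) (strand_at u j) + word_crossing_matrix v i j"
proof -
  have l: "over_strand (u @ v) t = over_strand u t" "under_strand (u @ v) t = under_strand u t"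
    if "t < length u" for t
    using that by (simp_all add: over_strand_def under_strand_def nth_append)
  have r: "over_strand (u @ v) (length u + t) = strand_at u (over_strand v t)"
      "under_strand (u @ v) (length u + t) = strand_at u (under_strand v t)" for t
    by (simp_all add: over_strand_def under_strand_def nth_append strand_at_append split: prod.split)
  let ?f = "\<lambda>t. if over_strand (u @ v) t = strand_at u i \<and> under_strand (u @ v) t = strand_at u j
    then crossing_sign ((u @ v) ! t) else 0"
  have split: "(\<Sum>t<m + k. f t) = (\<Sum>t<m. f t) + (\<Sum>t<k. f (m + t))"
    for f :: "nat \<Rightarrow> int" and m k
    by (induction k) simp_all
  have "(\<Sum>t<length u + length v. ?f t) = (\<Sum>t<length u. ?f t) + (\<Sum>t<length v. ?f (length u + t))"
    by (rule split)
  then show ?thesis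
    by (simp add: word_crossing_matrix_alt l r nth_append inj_eq[OF inj_strand_at] cong: if_cong)
qed

lemma word_crossing_matrix_Nil [simp]: "word_crossing_matrix [] x y = 0"
  by (simp add: word_crossing_matrix_alt)

lemma word_crossing_matrix_Cons:
  "word_crossing_matrix ((i, e) # w) x y =
    (if e then if x = Suc i \<and> y = i then 1 else 0 else if x = i \<and> y = Suc i then -1 else 0) +
    word_crossing_matrix w
      (Transposition.transpose i (Suc i) x) (Transposition.transpose i (Suc i) y)"
proof -
  let ?t = "Transposition.transpose i (Suc i)"
  have "strand_at [(i, e)] = ?t" by (simp add: strand_at_def)
  then have "word_crossing_matrix ((i, e) # w) x y =
      word_crossing_matrix [(i, e)] x y + word_crossing_matrix w (?t x) (?t y)"
    using word_crossing_matrix_append[of "[(i, e)]" w "?t x" "?t y"] by simp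
  moreover have "word_crossing_matrix [(i, e)] x y =
      (if e then if x = Suc i \<and> y = i then 1 else 0 else if x = i \<and> y = Suc i then -1 else 0)"
  proof -
    have s: "(\<Sum>t<length [(i, e)]. f t) = f 0" for f :: "nat \<Rightarrow> int" by simp
    show ?thesis
      unfolding word_crossing_matrix_alt s
      by (simp add: over_strand_def under_strand_def crossing_sign_def)
  qed
  ultimately show ?thesis by simp
qed

lemma transpose_eq_move:
  "Transposition.transpose a b x = y \<longleftrightarrow> x = Transposition.transpose a b y"
  by (metis Transposition.transpose_involutory)

lemma crossing_invariant:
  assumes "braid_eq n u v"
  shows "strand_at u = strand_at v \<and> word_crossing_matrix u = word_crossing_matrix v"
  using assms
proof (induction rule: braid_eq.induct)
  case (cong u u' v v')
  have "word_crossing_matrix (u @ v) x y = word_crossing_matrix (u' @ v') x y" for x y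
  proof -
    obtain i j where "x = strand_at u i" "y = strand_at u j"
      using surj_strand_at by (metis surjD)
    then show ?thesis
      using word_crossing_matrix_append[of u v i j] word_crossing_matrix_append[of u' v' i j] cong.IH
      by simp
  qed
  then show ?case using cong.IH by (auto simp: strand_at_append)
next
  case (cancel i e)
  have "word_crossing_matrix [(i, e), (i, \<not> e)] x y = 0" for x y
    by (auto simp: word_crossing_matrix_Cons transpose_eq_move)
  then show ?case by (auto simp: fun_eq_iff strand_at_def)
next
  case (far i j)
  then have t: "Transposition.transpose i (Suc i) j = j"
      "Transposition.transpose i (Suc i) (Suc j) = Suc j"
      "Transposition.transpose j (Suc j) i = i"
      "Transposition.transpose j (Suc j) (Suc i) = Suc i"
    by (simp_all add: Transposition.transpose_def)
  have "word_crossing_matrix [(i, True), (j, True)] x y =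
      word_crossing_matrix [(j, True), (i, True)] x y" for x y
    by (simp add: word_crossing_matrix_Cons transpose_eq_move t)
  moreover have "strand_at [(i, True), (j, True)] p = strand_at [(j, True), (i, True)] p" for p
  proof -
    consider "p = i" | "p = Suc i" | "p = j" | "p = Suc j" | "p \<notin> {i, Suc i, j, Suc j}" by blast
    then show ?thesis by cases (simp_all add: strand_at_def t)
  qed
  ultimately show ?case by (simp add: fun_eq_iff)
next
  case (braid i)
  have t: "Transposition.transpose i (Suc i) (Suc (Suc i)) = Suc (Suc i)"
      "Transposition.transpose (Suc i) (Suc (Suc i)) i = i"
    by (simp_all add: Transposition.transpose_def)
  have "word_crossing_matrix [(i, True), (Suc i, True), (i, True)] x y =
      word_crossing_matrix [(Suc i, True), (i, True), (Suc i, True)] x y" for x y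
    by (simp add: word_crossing_matrix_Cons transpose_eq_move t)
  moreover have "strand_at [(i, True), (Suc i, True), (i, True)] p =
      strand_at [(Suc i, True), (i, True), (Suc i, True)] p" for p
  proof -
    consider "p = i" | "p = Suc i" | "p = Suc (Suc i)" | "p \<notin> {i, Suc i, Suc (Suc i)}" by blast
    then show ?thesis by cases (simp_all add: strand_at_def t)
  qed
  ultimately show ?case by (simp add: fun_eq_iff)
qed auto

lemma crossing_matrix_class:
  assumes "w \<in> braid_words n"
  shows "crossing_matrix (braid_rel n `` {w}) i j = word_crossing_matrix w i j"
proof -
  have "word_crossing_matrix v i j = word_crossing_matrix w i j" if "v \<in> braid_rel n `` {w}" for v
    using that crossing_invariant[of n w v] by (simp add: braid_rel_def)
  moreover have "w \<in> braid_rel n `` {w}"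
    using assms by (simp add: braid_rel_def braid_eq.refl)
  ultimately have "(\<lambda>w. word_crossing_matrix w i j) ` (braid_rel n `` {w}) =
      {word_crossing_matrix w i j}"
    by blast
  then show ?thesis by (simp add: crossing_matrix_def)
qed

lemma pure_braid_class:
  assumes "w \<in> braid_words n"
  shows "pure_braid n (braid_rel n `` {w}) \<longleftrightarrow> (\<forall>p\<in>{1..n}. strand_at w p = p)"
proof -
  have "strand_at v = strand_at w" if "v \<in> braid_rel n `` {w}" for v
    using that crossing_invariant[of n w v] by (simp add: braid_rel_def)
  moreover have "w \<in> braid_rel n `` {w}"
    using assms by (simp add: braid_rel_def braid_eq.refl)
  ultimately show ?thesis unfolding pure_braid_def by metis
qed


section \<open>Braids as mapping classes of the punctured disk\<close>

definition disk :: "nat \<Rightarrow> complex set" where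
  "disk n = cball (complex_of_real ((real n + 1) / 2)) ((real n + 1) / 2)"

definition punctures :: "nat \<Rightarrow> complex set" where
  "punctures n = of_nat ` {1..n}"

definition disk_homeo :: "nat \<Rightarrow> (complex \<Rightarrow> complex) \<Rightarrow> bool" where
  "disk_homeo n f \<longleftrightarrow>
    (\<exists>g. homeomorphism (disk n) (disk n) f g) \<and>
    (\<forall>z\<in>frontier (disk n). f z = z) \<and> f ` punctures n = punctures n"

definition isotopic :: "nat \<Rightarrow> (complex \<Rightarrow> complex) \<Rightarrow> (complex \<Rightarrow> complex) \<Rightarrow> bool" where
  "isotopic n = homotopic_with_canon (disk_homeo n) (disk n) (disk n)"

text \<open>
  For \<open>s = -1\<close> (\<open>s = 1\<close>) the disk of radius 1/2 about \<open>i + 1/2\<close>, which has the punctures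
  \<open>i\<close> and \<open>i + 1\<close> on its boundary, is turned clockwise (counterclockwise) by a half turn; the
  twist fades out between the radii 1/2 and 1.
\<close>

definition half_twist :: "nat \<Rightarrow> real \<Rightarrow> complex \<Rightarrow> complex" where
  "half_twist i s z =
    (let c = complex_of_real (real i + 1 / 2)
     in c + (z - c) * cis (s * pi * max 0 (min 1 (2 - 2 * cmod (z - c)))))"

text \<open>
  The punctures are dragged along the strands from the upper to the lower bar, so later letters act
  later.  In the disk the imaginary axis points away from the viewer of the diagram.  In
  $\sigma_i$ the over strand, the one closer to the viewer, goes from \<open>i + 1\<close> to \<open>i\<close>
  through the lower half plane; so $\sigma_i$ is a clockwise half twist.
\<close>

definition braid_homeo :: "braid_word \<Rightarrow> complex \<Rightarrow> complex" where
  "braid_homeo w = fold (\<lambda>(i, e) f. half_twist i (if e then -1 else 1) \<circ> f) w id"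

definition mapping_class :: "nat \<Rightarrow> braid_word set \<Rightarrow> (complex \<Rightarrow> complex) set" where
  "mapping_class n b = {f. \<exists>w\<in>b. isotopic n (braid_homeo w) f}"

lemma half_twist_outside:
  assumes "1 \<le> cmod (z - complex_of_real (real i + 1 / 2))"
  shows "half_twist i s z = z"
  using assms by (simp add: half_twist_def Let_def max_def)

lemma norm_half_twist:
  "cmod (half_twist i s z - complex_of_real (real i + 1 / 2)) =
    cmod (z - complex_of_real (real i + 1 / 2))"
  by (simp add: half_twist_def Let_def norm_mult)

lemma half_twist_inverse: "half_twist i (- s) (half_twist i s z) = z"
proof -
  let ?c = "complex_of_real (real i + 1 / 2)"
  let ?a = "pi * max 0 (min 1 (2 - 2 * cmod (z - ?c)))"
  have 1: "half_twist i s z = ?c + (z - ?c) * cis (s * ?a)"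
    by (simp add: half_twist_def Let_def mult.assoc)
  have "half_twist i (- s) (half_twist i s z) =
      ?c + (half_twist i s z - ?c) * cis (- s * pi * max 0 (min 1 (2 - 2 * cmod (z - ?c))))"
    by (subst half_twist_def) (simp only: Let_def norm_half_twist)
  also have "\<dots> = ?c + (z - ?c) * (cis (s * ?a) * cis (- (s * ?a)))"
    by (simp add: 1 mult.assoc)
  also have "cis (s * ?a) * cis (- (s * ?a)) = 1"
    by (simp only: cis_mult) simp
  finally show ?thesis by simp
qed

lemma continuous_half_twist: "continuous_on S (half_twist i s)"
  unfolding half_twist_def Let_def by (intro continuous_intros)

lemma half_twist_puncture:
  assumes "s = 1 \<or> s = -1"
  shows "half_twist i s (of_nat k) = of_nat (Transposition.transpose i (Suc i) k)"
proof -
  let ?c = "complex_of_real (real i + 1 / 2)"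
  have d: "of_nat k - ?c = complex_of_real (real k - real i - 1 / 2)" by simp
  have n: "cmod (of_nat k - ?c) = \<bar>real k - real i - 1 / 2\<bar>" by (simp only: d norm_of_real)
  have c: "cis (s * pi) = -1" using assms by (auto simp: cis_conv_exp exp_minus)
  have m: "half_twist i s (of_nat k) = 2 * ?c - of_nat k" if "cmod (of_nat k - ?c) = 1 / 2"
  proof -
    have one: "s * pi * max 0 (min 1 (2 - 2 * (1 / 2))) = s * pi" by simp
    show ?thesis unfolding half_twist_def Let_def that one c by (simp add: algebra_simps)
  qed
  consider "k = i" | "k = Suc i" | "k < i" | "k > Suc i" by linarith
  then show ?thesis
  proof cases
    case 1
    then have "half_twist i s (of_nat k) = 2 * ?c - of_nat k" by (intro m) (simp add: n)
    then show ?thesis using 1 by simp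
  next
    case 2
    then have "half_twist i s (of_nat k) = 2 * ?c - of_nat k" by (intro m) (simp add: n)
    then show ?thesis using 2 by simp
  next
    case 3
    then have "1 \<le> cmod (of_nat k - ?c)" unfolding n by linarith
    with 3 show ?thesis by (simp add: half_twist_outside Transposition.transpose_def)
  next
    case 4
    then have "1 \<le> cmod (of_nat k - ?c)" unfolding n by linarith
    with 4 show ?thesis by (simp add: half_twist_outside Transposition.transpose_def)
  qed
qed

lemma disk_homeo_half_twist:
  assumes i: "i \<in> {1..<n}" and s: "s = 1 \<or> s = -1"
  shows "disk_homeo n (half_twist i s)"
proof -
  let ?c = "complex_of_real (real i + 1 / 2)"
  let ?d = "complex_of_real ((real n + 1) / 2)"
  have in_ball: "z \<in> ball ?d ((real n + 1) / 2)" if "cmod (z - ?c) < 1" for z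
  proof -
    have "real i \<ge> 1" "real i + 1 \<le> real n" using i by auto
    then have "real i + 1 / 2 - (real n + 1) / 2 \<le> real n / 2 - 1"
        "- (real i + 1 / 2 - (real n + 1) / 2) \<le> real n / 2 - 1"
      by (simp_all add: field_simps)
    then have "\<bar>real i + 1 / 2 - (real n + 1) / 2\<bar> \<le> real n / 2 - 1" by (rule abs_leI)
    moreover have "real n / 2 < (real n + 1) / 2" by simp
    ultimately have *: "x < (real n + 1) / 2"
      if "x \<le> y + \<bar>real i + 1 / 2 - (real n + 1) / 2\<bar>" "y < 1" for x y :: real
      using that by linarith
    have "cmod (?c - ?d) = \<bar>real i + 1 / 2 - (real n + 1) / 2\<bar>"
      by (simp only: of_real_diff[symmetric] norm_of_real)
    then have "cmod (z - ?d) \<le> cmod (z - ?c) + \<bar>real i + 1 / 2 - (real n + 1) / 2\<bar>"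
      using norm_triangle_ineq[of "z - ?c" "?c - ?d"] by (simp only: diff_add_cancel add_diff_eq)
    then have "cmod (z - ?d) < (real n + 1) / 2" using that by (rule *)
    then show ?thesis by (simp add: dist_norm norm_minus_commute del: of_real_divide)
  qed
  have into: "half_twist i s' z \<in> disk n" if "z \<in> disk n" for s' z
  proof (cases "cmod (z - ?c) < 1")
    case True
    then show ?thesis using in_ball[of "half_twist i s' z"] norm_half_twist
      by (auto simp: disk_def)
  next
    case False
    then show ?thesis using that by (simp add: half_twist_outside)
  qed
  have "homeomorphism (disk n) (disk n) (half_twist i s) (half_twist i (- s))"
    using into half_twist_inverse[of i s] half_twist_inverse[of i "- s"]
    by (intro homeomorphismI continuous_half_twist) auto
  moreover have "half_twist i s z = z" if "z \<in> frontier (disk n)" for z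
    using that in_ball[of z] half_twist_outside[of z i s] by (force simp: disk_def)
  moreover have "half_twist i s ` punctures n = punctures n"
  proof -
    have "half_twist i s ` punctures n =
        of_nat ` (Transposition.transpose i (Suc i) ` {1..n})"
      by (simp add: punctures_def image_image half_twist_puncture[OF s])
    also have "Transposition.transpose i (Suc i) ` {1..n} = {1..n}"
      using i by (intro Transposition.transpose_image_eq) auto
    finally show ?thesis by (simp add: punctures_def)
  qed
  ultimately show ?thesis unfolding disk_homeo_def by blast
qed

lemma disk_homeo_braid_homeo:
  "w \<in> braid_words n \<Longrightarrow> disk_homeo n (braid_homeo w)"
proof (induction w rule: rev_induct)
  case Nil
  have "homeomorphism (disk n) (disk n) id id" by (auto simp: homeomorphism_def)
  then have "disk_homeo n id"
    unfolding disk_homeo_def by (intro conjI exI[of _ id]) auto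
  then show ?case by (simp add: braid_homeo_def id_def)
next
  case (snoc x w)
  obtain i e where x: "x = (i, e)" by force
  let ?h = "half_twist i (if e then -1 else 1)"
  have "i \<in> {1..<n}" and w: "w \<in> braid_words n"
    using snoc.prems by (auto simp: braid_words_def x)
  then have h: "disk_homeo n ?h" by (intro disk_homeo_half_twist) auto
  have f: "disk_homeo n (braid_homeo w)" by (rule snoc.IH[OF w])
  obtain g g' where "homeomorphism (disk n) (disk n) (braid_homeo w) g"
      "homeomorphism (disk n) (disk n) ?h g'"
    using h f unfolding disk_homeo_def by blast
  then have "homeomorphism (disk n) (disk n) (?h \<circ> braid_homeo w) (g \<circ> g')"
    by (rule homeomorphism_compose)
  moreover have "\<forall>z\<in>frontier (disk n). (?h \<circ> braid_homeo w) z = z"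
    using h f unfolding disk_homeo_def o_apply by metis
  moreover have "(?h \<circ> braid_homeo w) ` punctures n = punctures n"
    using h f unfolding disk_homeo_def image_comp[symmetric] by metis
  ultimately have "disk_homeo n (?h \<circ> braid_homeo w)"
    unfolding disk_homeo_def by blast
  moreover have "braid_homeo (w @ [x]) = ?h \<circ> braid_homeo w"
    by (simp only: x braid_homeo_def fold_append o_apply fold.simps id_apply prod.case)
  ultimately show ?case by (simp only:)
qed

lemma braid_homeo_in_mapping_class:
  assumes "w \<in> braid_words n"
  shows "braid_homeo w \<in> mapping_class n (braid_rel n `` {w})"
proof -
  have h: "disk_homeo n (braid_homeo w)" using assms by (rule disk_homeo_braid_homeo)
  then have "continuous_on (disk n) (braid_homeo w)" "braid_homeo w ` disk n \<subseteq> disk n"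
    by (auto simp: disk_homeo_def homeomorphism_def)
  with h have "isotopic n (braid_homeo w) (braid_homeo w)"
    by (auto simp: isotopic_def)
  then show ?thesis
    using assms by (auto simp: mapping_class_def braid_rel_def intro: braid_eq.refl)
qed


section \<open>Periodic, reducible and pseudo-Anosov braids\<close>

definition periodic_braid :: "nat \<Rightarrow> braid_word set \<Rightarrow> bool" where
  "periodic_braid n b \<longleftrightarrow>
    (\<exists>k::nat. \<exists>m::int. k > 0 \<and>
      b [^]\<^bsub>braid_group n\<^esub> k = full_twist n [^]\<^bsub>braid_group n\<^esub> m)"

definition curve_in_punctured_disk :: "nat \<Rightarrow> complex set \<Rightarrow> bool" where
  "curve_in_punctured_disk n C \<longleftrightarrow>
    (\<exists>g. simple_path g \<and> pathfinish g = pathstart g \<and> path_image g = C) \<and>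
    C \<subseteq> interior (disk n) - punctures n"

definition reduction_system :: "nat \<Rightarrow> complex set set \<Rightarrow> bool" where
  "reduction_system n \<C> \<longleftrightarrow>
    \<C> \<noteq> {} \<and> pairwise disjnt \<C> \<and>
    (\<forall>C\<in>\<C>. curve_in_punctured_disk n C \<and>
      2 \<le> card (inside C \<inter> punctures n) \<and> card (inside C \<inter> punctures n) \<le> n - 1)"

text \<open>Families of curves are isotopic if an ambient isotopy carries one to the other.\<close>

definition isotopic_families :: "nat \<Rightarrow> complex set set \<Rightarrow> complex set set \<Rightarrow> bool" where
  "isotopic_families n \<C> \<D> \<longleftrightarrow> (\<exists>g. isotopic n id g \<and> (`) g ` \<C> = \<D>)"

definition reducible_braid :: "nat \<Rightarrow> braid_word set \<Rightarrow> bool" where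
  "reducible_braid n b \<longleftrightarrow>
    (\<exists>f\<in>mapping_class n b. \<exists>\<C>. reduction_system n \<C> \<and> isotopic_families n ((`) f ` \<C>) \<C>)"

text \<open>
  By the Nielsen--Thurston classification, exactly the braids that are neither periodic nor
  reducible are pseudo-Anosov.
\<close>

definition pseudo_anosov_braid :: "nat \<Rightarrow> braid_word set \<Rightarrow> bool" where
  "pseudo_anosov_braid n b \<longleftrightarrow>
    b \<in> carrier (braid_group n) \<and> \<not> periodic_braid n b \<and> \<not> reducible_braid n b"

end

theory Submission
  imports Defs "HOL-Complex_Analysis.Complex_Analysis"
begin

text \<open>
  The matrix obstructs periodicity and reducibility by itself, so any pure braid whose crossing
  matrix is \<open>a\<close> will do.  Such a braid exists: the crossing matrix is additive on pure braids, and
  the pure braid in which strand \<open>j\<close> runs once around strand \<open>i\<close> and returns has the symmetric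
  matrix with entry 1 at \<open>(i, j)\<close> and \<open>(j, i)\<close> and 0 elsewhere, because the crossings made on the
  way out and on the way back cancel (\<open>symmetric_matrix_realised\<close>).

  A power of the full twist has all off-diagonal entries equal.  By additivity the same holds for a
  periodic pure braid (\<open>periodic_crossing_matrix_constant\<close>), so \<open>a 3 1 \<noteq> a 3 2\<close> excludes it.

  For reducibility, let \<open>h\<close> be a homeomorphism in the mapping class of the pure braid that permutes
  the curves of a reduction system.  Along an isotopy of the disk from the identity to \<open>h\<close> that
  moves the punctures along the strands, the argument of the difference of two points changes
  continuously.  This defines a continuous logarithm \<open>\<theta> (x, y)\<close> of the quotient
  \<open>(h x - h y) / (x - y)\<close> on the pairs of distinct points of the disk, and at the punctures \<open>k\<close> and
  \<open>l\<close> its imaginary part is \<open>- \<pi>\<close> times the sum of the entries \<open>(k, l)\<close> and \<open>(l, k)\<close> of the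
  crossing matrix, since each crossing is a half turn (\<open>braid_homeo_arg_lift\<close>).  Let \<open>C\<close> be a
  reduction curve.  As \<open>h\<close> fixes the punctures, \<open>C\<close> and \<open>h ` C\<close> enclose the same punctures, and as
  they are equal or disjoint, their insides are nested.  So both insides lie in one simply connected
  region that misses a given puncture \<open>k\<close> outside, where \<open>k - z\<close> has a continuous logarithm
  \<open>L z\<close>.  Then \<open>\<theta> (k, y)\<close> and \<open>L (h y) - L y\<close> differ by a constant for \<open>y\<close> inside \<open>C\<close>, and at
  a puncture the second term is 0.  Hence \<open>\<theta> (k, l)\<close> is the same for all punctures \<open>l\<close> inside
  \<open>C\<close>, and for a symmetric crossing matrix so is the entry \<open>(k, l)\<close>
  (\<open>reducible_crossing_matrix\<close>).  This is what the hypothesis on \<open>a\<close> forbids.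
\<close>

section \<open>Crossing matrices of pure braids\<close>

lemma strand_at_fixes_outside:
  assumes "w \<in> braid_words n" "p \<notin> {1..n}"
  shows "strand_at w p = p"
  using assms(1)
proof (induction w rule: rev_induct)
  case (snoc x w)
  obtain i e where x: "x = (i, e)" by force
  have "i \<in> {1..<n}" "w \<in> braid_words n"
    using snoc.prems by (auto simp: braid_words_def x)
  then have "Transposition.transpose i (Suc i) p = p" "strand_at w p = p"
    using assms(2) snoc.IH by (auto simp: Transposition.transpose_def)
  then show ?case by (simp add: x strand_at_snoc)
qed simp

lemma pure_braid_iff_strand_id:
  assumes "w \<in> braid_words n"
  shows "pure_braid n (braid_rel n `` {w}) \<longleftrightarrow> strand_at w = id"
  unfolding pure_braid_class[OF assms]
  using strand_at_fixes_outside[OF assms] by (metis eq_id_iff)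

lemma word_crossing_matrix_append_pure:
  assumes "strand_at u = id"
  shows "word_crossing_matrix (u @ v) x y = word_crossing_matrix u x y + word_crossing_matrix v x y"
  using word_crossing_matrix_append[of u v x y] assms by simp

definition pure_matrix :: "nat \<Rightarrow> (nat \<Rightarrow> nat \<Rightarrow> int) \<Rightarrow> bool" where
  "pure_matrix n A \<longleftrightarrow> (\<exists>w\<in>braid_words n. strand_at w = id \<and> A = word_crossing_matrix w)"

lemma pure_matrixI:
  "w \<in> braid_words n \<Longrightarrow> strand_at w = id \<Longrightarrow> pure_matrix n (word_crossing_matrix w)"
  by (auto simp: pure_matrix_def)

lemma pure_matrix_zero: "pure_matrix n (\<lambda>x y. 0)"
proof -
  have "word_crossing_matrix [] = (\<lambda>x y. 0)" by (intro ext) simp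
  then show ?thesis using pure_matrixI[of "[]" n] by (simp add: braid_words_def)
qed

lemma pure_matrix_add:
  assumes "pure_matrix n A" "pure_matrix n B"
  shows "pure_matrix n (\<lambda>x y. A x y + B x y)"
proof -
  obtain u v where u: "u \<in> braid_words n" "strand_at u = id" "A = word_crossing_matrix u"
    and v: "v \<in> braid_words n" "strand_at v = id" "B = word_crossing_matrix v"
    using assms by (auto simp: pure_matrix_def)
  have "(\<lambda>x y. A x y + B x y) = word_crossing_matrix (u @ v)"
    using u v by (intro ext) (simp add: word_crossing_matrix_append_pure)
  then show ?thesis
    using u v pure_matrixI[of "u @ v" n] by (simp add: strand_at_append)
qed

lemma pure_matrix_uminus:
  assumes "pure_matrix n A"
  shows "pure_matrix n (\<lambda>x y. - A x y)"
proof -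
  obtain u where u: "u \<in> braid_words n" "strand_at u = id" "A = word_crossing_matrix u"
    using assms by (auto simp: pure_matrix_def)
  obtain v where v: "v \<in> braid_words n" "braid_eq n (v @ u) []"
    using braid_word_inverse[OF u(1)] by blast
  have inv: "strand_at (v @ u) = id" "word_crossing_matrix (v @ u) = word_crossing_matrix []"
    using crossing_invariant[OF v(2)] by auto
  then have sv: "strand_at v = id" using u by (simp add: strand_at_append)
  have "word_crossing_matrix v = (\<lambda>x y. - A x y)"
  proof (intro ext)
    fix x y
    have "word_crossing_matrix v x y + word_crossing_matrix u x y = 0"
      using word_crossing_matrix_append_pure[OF sv, of u x y] inv(2) by simp
    then show "word_crossing_matrix v x y = - A x y" using u(3) by simp
  qed
  then show ?thesis using pure_matrixI[OF v(1) sv] by simp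
qed

lemma pure_matrix_scale:
  assumes "pure_matrix n A"
  shows "pure_matrix n (\<lambda>x y. c * A x y)"
proof -
  have pos: "pure_matrix n (\<lambda>x y. int m * A x y)" for m
  proof (induction m)
    case (Suc m)
    show ?case using pure_matrix_add[OF Suc assms] by (simp add: algebra_simps)
  qed (simp add: pure_matrix_zero)
  show ?thesis
  proof (cases "c \<ge> 0")
    case True
    then show ?thesis using pos[of "nat c"] by simp
  next
    case False
    then show ?thesis using pure_matrix_uminus[OF pos[of "nat (- c)"]] by simp
  qed
qed

text \<open>
  Conjugating by \<open>\<sigma>\<^sub>i\<close> renames the strands.  The two crossings added involve the same two strands
  with the same one on top and have opposite signs, so they cancel.
\<close>

lemma pure_matrix_transpose:
  assumes "pure_matrix n A" and i: "i \<in> {1..<n}"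
  defines "\<tau> \<equiv> Transposition.transpose i (Suc i)"
  shows "pure_matrix n (\<lambda>x y. A (\<tau> x) (\<tau> y))"
proof -
  obtain u where u: "u \<in> braid_words n" "strand_at u = id" "A = word_crossing_matrix u"
    using assms(1) by (auto simp: pure_matrix_def)
  let ?w = "(i, True) # u @ [(i, False)]"
  have "(\<lambda>x y. A (\<tau> x) (\<tau> y)) = word_crossing_matrix ?w"
    using u unfolding \<tau>_def
    by (intro ext) (auto simp: word_crossing_matrix_Cons word_crossing_matrix_append_pure
        transpose_eq_move)
  moreover have "strand_at ?w = id"
  proof -
    have "?w = [(i, True)] @ u @ [(i, False)]" by simp
    then have "strand_at ?w = strand_at [(i, True)] \<circ> (strand_at u \<circ> strand_at [(i, False)])"
      by (simp only: strand_at_append)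
    then show ?thesis using u by (auto simp: strand_at_def fun_eq_iff)
  qed
  moreover have "?w \<in> braid_words n" using u i by (auto simp: braid_words_def)
  ultimately show ?thesis using pure_matrixI[of ?w n] by simp
qed


text \<open>
  Starting from \<open>\<sigma>\<^sub>i\<^sup>2\<close>, repeated conjugation moves the second index to the right.
\<close>

lemma pure_matrix_elementary:
  assumes "1 \<le> i" "Suc i + d \<le> n"
  shows "pure_matrix n (\<lambda>x y. if {x, y} = {i, Suc i + d} then 1 else 0)"
  using assms(2)
proof (induction d)
  case 0
  have "word_crossing_matrix [(i, True), (i, True)] = (\<lambda>x y. if {x, y} = {i, Suc i + 0} then 1 else 0)"
    by (intro ext) (auto simp: word_crossing_matrix_Cons transpose_eq_move doubleton_eq_iff)
  moreover have "strand_at [(i, True), (i, True)] = id" by (auto simp: strand_at_def)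
  moreover have "[(i, True), (i, True)] \<in> braid_words n"
    using assms(1) 0 by (auto simp: braid_words_def)
  ultimately show ?case by (metis pure_matrixI)
next
  case (Suc d)
  let ?\<tau> = "Transposition.transpose (Suc i + d) (Suc (Suc i + d))"
  have "pure_matrix n (\<lambda>x y. if {?\<tau> x, ?\<tau> y} = {i, Suc i + d} then 1 else 0)"
    using Suc by (intro pure_matrix_transpose) auto
  moreover have "{?\<tau> x, ?\<tau> y} = {i, Suc i + d} \<longleftrightarrow> {x, y} = {i, Suc i + Suc d}" for x y
    by (auto simp: doubleton_eq_iff transpose_eq_move)
  ultimately show ?case by simp
qed

proposition symmetric_matrix_realised:
  fixes a :: "nat \<Rightarrow> nat \<Rightarrow> int"
  assumes diag: "\<forall>i\<in>{1..n}. a i i = 0"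
    and sym: "\<forall>i\<in>{1..n}. \<forall>j\<in>{1..n}. a i j = a j i"
  obtains w where "w \<in> braid_words n" "strand_at w = id"
    "\<And>i j. i \<in> {1..n} \<Longrightarrow> j \<in> {1..n} \<Longrightarrow> word_crossing_matrix w i j = a i j"
proof -
  define E where "E = (\<lambda>p x y::nat. if {x, y} = {fst p, snd p} then 1 else 0 :: int)"
  define T where "T = {(i, j). 1 \<le> i \<and> i < j \<and> j \<le> n}"
  have fin: "finite T"
    by (rule finite_subset[of _ "{1..n} \<times> {1..n}"]) (auto simp: T_def)
  have E: "pure_matrix n (E p)" if "p \<in> T" for p
    using that pure_matrix_elementary[of "fst p" "snd p - Suc (fst p)" n]
    by (auto simp: E_def T_def)
  have "pure_matrix n (\<lambda>x y. \<Sum>p\<in>F. a (fst p) (snd p) * E p x y)" if "finite F" "F \<subseteq> T" for F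
    using that
  proof (induction F rule: finite_induct)
    case (insert p F)
    then show ?case
      using pure_matrix_add[OF pure_matrix_scale[OF E, of p "a (fst p) (snd p)"]]
      by simp
  qed (simp add: pure_matrix_zero)
  from this[OF fin subset_refl] obtain w
    where w: "w \<in> braid_words n" "strand_at w = id"
      "(\<lambda>x y. \<Sum>p\<in>T. a (fst p) (snd p) * E p x y) = word_crossing_matrix w"
    by (auto simp: pure_matrix_def)
  have "word_crossing_matrix w x y = a x y" if xy: "x \<in> {1..n}" "y \<in> {1..n}" for x y
  proof (cases "x = y")
    case True
    then have "E p x y = 0" if "p \<in> T" for p using that by (auto simp: E_def T_def)
    then show ?thesis using True diag xy by (simp flip: w(3))
  next
    case False
    let ?q = "(min x y, max x y)"
    have q: "?q \<in> T" using False xy by (auto simp: T_def)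
    have Eq: "E p x y = (if p = ?q then 1 else 0)" if "p \<in> T" for p
      using that False by (auto simp: E_def T_def doubleton_eq_iff min_def max_def)
    have "(\<Sum>p\<in>T. a (fst p) (snd p) * E p x y) = (\<Sum>p\<in>T. if p = ?q then a (min x y) (max x y) else 0)"
      by (rule sum.cong) (auto simp: Eq)
    also have "\<dots> = a (min x y) (max x y)" using fin q by simp
    also have "\<dots> = a x y" using sym xy by (simp add: min_def max_def)
    finally show ?thesis by (simp flip: w(3))
  qed
  then show ?thesis using that w by blast
qed

section \<open>Periodic pure braids\<close>

lemma pure_braid_mult:
  assumes b: "b \<in> carrier (braid_group n)" "pure_braid n b"
    and c: "c \<in> carrier (braid_group n)" "pure_braid n c"
  shows "pure_braid n (b \<otimes>\<^bsub>braid_group n\<^esub> c)"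
    and "crossing_matrix (b \<otimes>\<^bsub>braid_group n\<^esub> c) x y = crossing_matrix b x y + crossing_matrix c x y"
proof -
  obtain u v where u: "u \<in> braid_words n" "b = braid_rel n `` {u}"
    and v: "v \<in> braid_words n" "c = braid_rel n `` {v}"
    using b c by (metis braid_group_cases)
  have "strand_at u = id" "strand_at v = id"
    using b c u v by (simp_all add: pure_braid_iff_strand_id)
  then show "pure_braid n (b \<otimes>\<^bsub>braid_group n\<^esub> c)"
    and "crossing_matrix (b \<otimes>\<^bsub>braid_group n\<^esub> c) x y = crossing_matrix b x y + crossing_matrix c x y"
    using u v by (simp_all add: mult_braid_class pure_braid_iff_strand_id crossing_matrix_class
        strand_at_append word_crossing_matrix_append_pure)
qed

lemma pure_braid_one:
  "pure_braid n \<one>\<^bsub>braid_group n\<^esub>" "crossing_matrix \<one>\<^bsub>braid_group n\<^esub> x y = 0"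
proof -
  have "[] \<in> braid_words n" by (simp add: braid_words_def)
  then show "pure_braid n \<one>\<^bsub>braid_group n\<^esub>" "crossing_matrix \<one>\<^bsub>braid_group n\<^esub> x y = 0"
    by (simp_all add: one_braid_group pure_braid_iff_strand_id crossing_matrix_class)
qed

lemma pure_braid_pow:
  assumes b: "b \<in> carrier (braid_group n)" "pure_braid n b"
  shows "pure_braid n (b [^]\<^bsub>braid_group n\<^esub> (k::nat))"
    and "crossing_matrix (b [^]\<^bsub>braid_group n\<^esub> k) x y = int k * crossing_matrix b x y"
proof -
  interpret group "braid_group n" by (rule group_braid_group)
  have "pure_braid n (b [^]\<^bsub>braid_group n\<^esub> k) \<and>
    crossing_matrix (b [^]\<^bsub>braid_group n\<^esub> k) x y = int k * crossing_matrix b x y"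
  proof (induction k)
    case (Suc k)
    then show ?case
      using pure_braid_mult[OF nat_pow_closed[OF b(1), of k] _ b] by (simp add: algebra_simps)
  qed (simp add: pure_braid_one)
  then show "pure_braid n (b [^]\<^bsub>braid_group n\<^esub> k)"
    and "crossing_matrix (b [^]\<^bsub>braid_group n\<^esub> k) x y = int k * crossing_matrix b x y"
    by auto
qed

definition rotation_word :: "nat \<Rightarrow> braid_word" where
  "rotation_word n = map (\<lambda>i. (i, True)) [1..<n]"

lemma rotation_word_in [simp]: "rotation_word n \<in> braid_words n"
  by (auto simp: rotation_word_def braid_words_def)

lemma strand_at_rotation_word:
  assumes "1 \<le> n"
  shows "strand_at (rotation_word n) p =
    (if p \<in> {1..<n} then Suc p else if p = n then 1 else p)"
  using assms
proof (induction n arbitrary: p rule: dec_induct)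
  case base
  then show ?case by (simp add: rotation_word_def)
next
  case (step n)
  have "rotation_word (Suc n) = rotation_word n @ [(n, True)]"
    using step.hyps by (simp add: rotation_word_def)
  then show ?case
    using step by (auto simp: strand_at_snoc Transposition.transpose_def)
qed

text \<open>
  In \<open>\<sigma>\<^sub>1 \<dots> \<sigma>\<^sub>n\<^sub>-\<^sub>1\<close> the first strand passes under all the others to the last position.
\<close>

lemma word_crossing_matrix_rotation_word:
  assumes "1 \<le> n"
  shows "word_crossing_matrix (rotation_word n) x y = (if y = 1 \<and> x \<in> {2..n} then 1 else 0)"
  using assms
proof (induction n arbitrary: x y rule: dec_induct)
  case base
  then show ?case by (simp add: rotation_word_def)
next
  case (step n)
  let ?s = "strand_at (rotation_word n)"
  have r: "rotation_word (Suc n) = rotation_word n @ [(n, True)]"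
    using step.hyps by (simp add: rotation_word_def)
  obtain p q where pq: "x = ?s p" "y = ?s q" using surj_strand_at by (metis surjD)
  have "word_crossing_matrix (rotation_word (Suc n)) x y =
      word_crossing_matrix (rotation_word n) x y + word_crossing_matrix [(n, True)] p q"
    unfolding r pq by (rule word_crossing_matrix_append)
  moreover have "word_crossing_matrix [(n, True)] p q = (if p = Suc n \<and> q = n then 1 else 0)"
    by (simp add: word_crossing_matrix_Cons)
  moreover have "p = Suc n \<and> q = n \<longleftrightarrow> x = Suc n \<and> y = 1"
    using step.hyps unfolding pq by (auto simp: strand_at_rotation_word split: if_splits)
  ultimately show ?case using step by auto
qed

lemma strand_at_rotation_power:
  "strand_at (concat (replicate t w)) = strand_at w ^^ t"
  by (induction t) (simp_all add: strand_at_append)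

lemma rotation_power_first:
  assumes "t < n"
  shows "(strand_at (rotation_word n) ^^ t) 1 = Suc t"
  using assms by (induction t) (auto simp: strand_at_rotation_word)

lemma rotation_power_range:
  assumes "1 \<le> n"
  shows "(strand_at (rotation_word n) ^^ t) p \<in> {1..n} \<longleftrightarrow> p \<in> {1..n}"
  using assms by (induction t) (auto simp: strand_at_rotation_word)

text \<open>
  The strands \<open>1, 2, \<dots>\<close> take turns in passing under all the others: the strand that starts the
  \<open>t\<close>-th rotation in the first position is \<open>t\<close>, which is \<open>rotation_power_first\<close>.  The bound
  \<open>t \<le> n\<close> says that no strand has had its second turn.
\<close>

lemma rotation_power_crossing_matrix:
  assumes "t \<le> n"
  shows "word_crossing_matrix (concat (replicate t (rotation_word n))) x y =
    (if x \<in> {1..n} \<and> y \<in> {1..t} \<and> x \<noteq> y then 1 else 0)"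
  using assms
proof (induction t arbitrary: x y)
  case (Suc t)
  let ?r = "rotation_word n" and ?u = "concat (replicate t (rotation_word n))"
  have u: "concat (replicate (Suc t) ?r) = ?u @ ?r"
  proof -
    have "replicate (Suc t) ?r = replicate t ?r @ [?r]" by (simp add: replicate_append_same)
    then show ?thesis by (simp only: concat_append) simp
  qed
  obtain p q where pq: "x = strand_at ?u p" "y = strand_at ?u q"
    using surj_strand_at by (metis surjD)
  have "word_crossing_matrix (concat (replicate (Suc t) ?r)) x y =
      word_crossing_matrix ?u x y + word_crossing_matrix ?r p q"
    unfolding u pq by (rule word_crossing_matrix_append)
  moreover have "q = 1 \<and> p \<in> {2..n} \<longleftrightarrow> y = Suc t \<and> x \<in> {1..n} \<and> x \<noteq> y"
  proof -
    have "strand_at ?u 1 = Suc t"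
      using Suc.prems rotation_power_first[of t n] by (simp add: strand_at_rotation_power)
    then have "q = 1 \<longleftrightarrow> y = Suc t" "p = 1 \<longleftrightarrow> x = Suc t"
      unfolding pq by (metis inj_eq inj_strand_at)+
    moreover have "p \<in> {1..n} \<longleftrightarrow> x \<in> {1..n}"
      using Suc.prems unfolding pq by (simp only: strand_at_rotation_power rotation_power_range)
    moreover have "p \<in> {2..n} \<longleftrightarrow> p \<in> {1..n} \<and> p \<noteq> 1" by auto
    ultimately show ?thesis by auto
  qed
  ultimately show ?case
    using Suc by (auto simp: word_crossing_matrix_rotation_word)
qed simp

lemma full_twist_pure:
  assumes "1 \<le> n"
  shows "pure_braid n (full_twist n)"
    and "crossing_matrix (full_twist n) x y = (if x \<in> {1..n} \<and> y \<in> {1..n} \<and> x \<noteq> y then 1 else 0)"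
proof -
  let ?r = "rotation_word n" let ?w = "concat (replicate n ?r)"
  have tw: "full_twist n = braid_rel n `` {?w}" by (simp add: full_twist_def rotation_word_def)
  have w: "?w \<in> braid_words n"
    using rotation_word_in[of n] by (auto simp: braid_words_def in_lists_conv_set)
  let ?c = "strand_at ?r"
  have "(?c ^^ n) p = p" if "p \<in> {1..n}" for p
  proof -
    have one: "(?c ^^ n) 1 = 1"
    proof -
      obtain m where m: "n = Suc m" using assms by (cases n) auto
      have "(?c ^^ n) 1 = ?c ((?c ^^ m) 1)" unfolding m by simp
      also have "\<dots> = ?c n" using rotation_power_first[of m n] m by simp
      finally show ?thesis using assms by (simp add: strand_at_rotation_word)
    qed
    have p: "p = (?c ^^ (p - 1)) 1" using that rotation_power_first[of "p - 1" n] by auto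
    have "(?c ^^ n) ((?c ^^ (p - 1)) 1) = (?c ^^ (p - 1)) ((?c ^^ n) 1)"
      by (metis add.commute comp_apply funpow_add)
    then show ?thesis using one p by metis
  qed
  then show "pure_braid n (full_twist n)"
    unfolding tw pure_braid_class[OF w] by (simp add: strand_at_rotation_power)
  show "crossing_matrix (full_twist n) x y = (if x \<in> {1..n} \<and> y \<in> {1..n} \<and> x \<noteq> y then 1 else 0)"
    unfolding tw crossing_matrix_class[OF w] by (simp add: rotation_power_crossing_matrix)
qed

proposition periodic_crossing_matrix_constant:
  assumes b: "b \<in> carrier (braid_group n)" "pure_braid n b" and per: "periodic_braid n b"
    and ij: "i \<in> {1..n}" "j \<in> {1..n}" "i \<noteq> j" and kl: "k \<in> {1..n}" "l \<in> {1..n}" "k \<noteq> l"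
  shows "crossing_matrix b i j = crossing_matrix b k l"
proof -
  interpret group "braid_group n" by (rule group_braid_group)
  let ?F = "full_twist n"
  have n: "1 \<le> n" using ij by auto
  note F = full_twist_in_carrier[of n] full_twist_pure(1)[OF n]
  obtain r :: nat and m :: int
    where r: "r > 0" and eq: "b [^]\<^bsub>braid_group n\<^esub> r = ?F [^]\<^bsub>braid_group n\<^esub> m"
    using per by (auto simp: periodic_braid_def)
  have "int r * crossing_matrix b x y = m * crossing_matrix ?F x y" for x y
  proof (cases "m \<ge> 0")
    case True
    then have "?F [^]\<^bsub>braid_group n\<^esub> m = ?F [^]\<^bsub>braid_group n\<^esub> nat m"
      using int_pow_int[of _ ?F "nat m"] by simp
    then show ?thesis
      using True pure_braid_pow(2)[OF b, of r x y] pure_braid_pow(2)[OF F, of "nat m" x y] eq by simp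
  next
    case False
    have "?F [^]\<^bsub>braid_group n\<^esub> m = inv\<^bsub>braid_group n\<^esub> (?F [^]\<^bsub>braid_group n\<^esub> nat (- m))"
      using False F(1) by (metis int_nat_eq int_pow_int int_pow_neg less_imp_le minus_minus neg_less_0_iff_less not_le)
    then have "b [^]\<^bsub>braid_group n\<^esub> r \<otimes>\<^bsub>braid_group n\<^esub> ?F [^]\<^bsub>braid_group n\<^esub> nat (- m) = \<one>\<^bsub>braid_group n\<^esub>"
      unfolding eq using F(1) by simp
    then have "int r * crossing_matrix b x y + int (nat (- m)) * crossing_matrix ?F x y = 0"
      using pure_braid_mult(2)[OF nat_pow_closed[OF b(1)] pure_braid_pow(1)[OF b]
          nat_pow_closed[OF F(1)] pure_braid_pow(1)[OF F], of r "nat (- m)" x y]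
      by (simp add: pure_braid_one pure_braid_pow(2)[OF b] pure_braid_pow(2)[OF F])
    then show ?thesis using False by simp
  qed
  then have "int r * crossing_matrix b i j = int r * crossing_matrix b k l"
    using ij kl by (simp add: full_twist_pure(2)[OF n])
  then show ?thesis using r by simp
qed


section \<open>Continuous arguments of difference quotients\<close>

definition config :: "complex set \<Rightarrow> (complex \<times> complex) set" where
  "config D = {(x, y). x \<in> D \<and> y \<in> D \<and> x \<noteq> y}"

text \<open>
  For a homeomorphism \<open>f\<close> of a disk, a continuous logarithm of \<open>(f x - f y) / (x - y)\<close> amounts to a
  choice, up to a common multiple of \<open>2 \<pi> \<i>\<close>, of how far the vector from \<open>y\<close> to \<open>x\<close> turns under \<open>f\<close>.
  Multiplying out the quotient makes the compositions below free of division.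
\<close>

definition arg_lift :: "complex set \<Rightarrow> (complex \<Rightarrow> complex) \<Rightarrow> (complex \<times> complex \<Rightarrow> complex) \<Rightarrow> bool"
  where "arg_lift D f \<theta> \<longleftrightarrow> continuous_on (config D) \<theta> \<and>
    (\<forall>x\<in>D. \<forall>y\<in>D. x \<noteq> y \<longrightarrow> exp (\<theta> (x, y)) * (x - y) = f x - f y)"

lemma arg_lift_exp:
  assumes "arg_lift D f \<theta>" "x \<in> D" "y \<in> D" "x \<noteq> y"
  shows "exp (\<theta> (x, y)) * (x - y) = f x - f y"
  using assms by (simp add: arg_lift_def)

lemma arg_lift_imp_inj:
  assumes "arg_lift D f \<theta>"
  shows "inj_on f D"
proof (rule inj_onI, rule ccontr)
  fix x y assume "x \<in> D" "y \<in> D" "f x = f y" "x \<noteq> y"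
  then show False using arg_lift_exp[OF assms, of x y] by simp
qed

lemma arg_lift_subset: "arg_lift D f \<theta> \<Longrightarrow> E \<subseteq> D \<Longrightarrow> arg_lift E f \<theta>"
  unfolding arg_lift_def by (auto simp: config_def intro: continuous_on_subset)

lemma arg_lift_id: "arg_lift D id (\<lambda>_. 0)"
  by (simp add: arg_lift_def)

lemma arg_lift_compose:
  assumes f: "arg_lift D f \<theta>" "continuous_on D f" "f ` D \<subseteq> E" and g: "arg_lift E g \<eta>"
  shows "arg_lift D (g \<circ> f) (\<lambda>(x, y). \<theta> (x, y) + \<eta> (f x, f y))"
proof -
  have "continuous_on (config D) (\<lambda>p. (f (fst p), f (snd p)))"
    by (intro continuous_intros continuous_on_compose2[OF f(2)]) (auto simp: config_def)
  moreover have "(\<lambda>p. (f (fst p), f (snd p))) ` config D \<subseteq> config E"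
    using f(3) arg_lift_imp_inj[OF f(1)] by (auto simp: config_def inj_on_def)
  ultimately have "continuous_on (config D) (\<lambda>p. \<eta> (f (fst p), f (snd p)))"
    using continuous_on_compose2[of "config E" \<eta> "config D" "\<lambda>p. (f (fst p), f (snd p))"] g
    by (simp add: arg_lift_def)
  then have "continuous_on (config D) (\<lambda>p. \<theta> p + \<eta> (f (fst p), f (snd p)))"
    using f(1) unfolding arg_lift_def by (intro continuous_on_add) auto
  moreover have "exp (\<theta> (x, y) + \<eta> (f x, f y)) * (x - y) = g (f x) - g (f y)"
    if "x \<in> D" "y \<in> D" "x \<noteq> y" for x y
  proof -
    have "f x \<noteq> f y" using that arg_lift_imp_inj[OF f(1)] by (auto simp: inj_on_def)
    then have "exp (\<eta> (f x, f y)) * (f x - f y) = g (f x) - g (f y)"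
      using f(3) that by (intro arg_lift_exp[OF g]) auto
    then show ?thesis
      by (simp flip: arg_lift_exp[OF f(1) that] add: exp_add mult.commute mult.left_commute)
  qed
  ultimately show ?thesis by (simp add: arg_lift_def case_prod_unfold)
qed

lemma continuous_log_unique:
  fixes u v :: "'a::topological_space \<Rightarrow> complex"
  assumes "connected T" "continuous_on T u" "continuous_on T v"
    and "\<And>t. t \<in> T \<Longrightarrow> exp (u t) = exp (v t)"
    and "a \<in> T" "u a = v a" "b \<in> T"
  shows "u b = v b"
  by (rule covering_space_lift_unique[OF covering_space_exp_punctured_plane assms(6)
        continuous_on_exp[OF assms(2)] _ assms(2) _ HOL.refl assms(3) _ _ assms(1,5,7)])
     (simp_all add: assms(4))

text \<open>
  This is homotopy lifting along the covering \<open>exp\<close>.  The second property determines the new lift at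
  a pair of points from the motion of this pair alone, as lifts of paths are unique.
\<close>

lemma arg_lift_homotopy:
  fixes K :: "real \<times> complex \<Rightarrow> complex"
  assumes \<theta>: "arg_lift D f \<theta>" and K0: "\<And>z. z \<in> D \<Longrightarrow> K (0, z) = f z"
    and K: "continuous_on ({0..1} \<times> D) K" and inj: "\<And>t. t \<in> {0..1} \<Longrightarrow> inj_on (\<lambda>z. K (t, z)) D"
  obtains \<eta> where "arg_lift D (\<lambda>z. K (1, z)) \<eta>"
    "\<And>x y u. (x, y) \<in> config D \<Longrightarrow> continuous_on {0..1} u \<Longrightarrow> u 0 = \<theta> (x, y) \<Longrightarrow>
      (\<And>t. t \<in> {0..1} \<Longrightarrow> exp (u t) * (x - y) = K (t, x) - K (t, y)) \<Longrightarrow> \<eta> (x, y) = u 1"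
proof -
  define q where "q = (\<lambda>(t, p). (K (t, fst p) - K (t, snd p)) / (fst p - snd p))"
  have q: "q (t, (x, y)) = (K (t, x) - K (t, y)) / (x - y)" for t x y by (simp add: q_def)
  have cont: "continuous_on ({0..1} \<times> config D) q"
    unfolding q_def case_prod_unfold
    by (intro continuous_intros continuous_on_compose2[OF K]) (auto simp: config_def)
  have nz: "q \<in> {0..1} \<times> config D \<rightarrow> - {0}"
    using inj by (auto simp: q config_def inj_on_def)
  have q0: "q (0, p) = exp (\<theta> p)" if "p \<in> config D" for p
    using that arg_lift_exp[OF \<theta>] K0 by (cases p) (auto simp: q config_def field_simps)
  obtain L where L: "continuous_on ({0..1} \<times> config D) L"
      "\<And>p. p \<in> config D \<Longrightarrow> L (0, p) = \<theta> p"
      "\<And>z. z \<in> {0..1} \<times> config D \<Longrightarrow> q z = exp (L z)"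
    by (rule covering_space_lift_homotopy[OF covering_space_exp_punctured_plane cont nz q0])
       (use \<theta> in \<open>auto simp: arg_lift_def\<close>)
  show ?thesis
  proof
    have "continuous_on (config D) (\<lambda>p. L (1, p))"
      by (intro continuous_on_compose2[OF L(1)] continuous_intros) auto
    moreover have "exp (L (1, (x, y))) * (x - y) = K (1, x) - K (1, y)"
      if "x \<in> D" "y \<in> D" "x \<noteq> y" for x y
      using that L(3)[of "(1, (x, y))"] by (auto simp: config_def q field_simps)
    ultimately show "arg_lift D (\<lambda>z. K (1, z)) (\<lambda>p. L (1, p))" by (simp add: arg_lift_def)
  next
    fix x y and u :: "real \<Rightarrow> complex"
    assume xy: "(x, y) \<in> config D" and u: "continuous_on {0..1} u" "u 0 = \<theta> (x, y)"
      "\<And>t. t \<in> {0..1} \<Longrightarrow> exp (u t) * (x - y) = K (t, x) - K (t, y)"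
    have "exp (L (t, (x, y))) = exp (u t)" if "t \<in> {0..1}" for t
    proof -
      have "x \<noteq> y" using xy by (simp add: config_def)
      moreover have "exp (L (t, (x, y))) = (K (t, x) - K (t, y)) / (x - y)"
        using that xy L(3)[of "(t, (x, y))"] by (simp add: q)
      ultimately show ?thesis by (simp flip: u(3)[OF that])
    qed
    moreover have "continuous_on {0..1} (\<lambda>t. L (t, (x, y)))"
      using xy by (intro continuous_on_compose2[OF L(1)] continuous_intros) auto
    ultimately show "L (1, (x, y)) = u 1"
      using u(1,2) L(2)[OF xy]
      by (intro continuous_log_unique[of "{0..1}" "\<lambda>t. L (t, (x, y))" u 0 1]) simp_all
  qed
qed

lemma punctures_subset_disk: "punctures n \<subseteq> disk n"
proof
  fix z assume "z \<in> punctures n"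
  then obtain k where k: "z = of_nat k" "1 \<le> k" "k \<le> n" by (auto simp: punctures_def)
  have "dist (complex_of_real ((real n + 1) / 2)) (complex_of_real (real k)) =
      \<bar>(real n + 1) / 2 - real k\<bar>"
    by (simp only: dist_of_real dist_real_def)
  also have "\<dots> \<le> (real n + 1) / 2" using k by (simp add: abs_le_iff field_simps)
  finally show "z \<in> disk n" using k by (simp add: disk_def)
qed

text \<open>
  During an isotopy through homeomorphisms that preserve the finite set of punctures, a puncture
  cannot move at all.  So the lift is constant at pairs of punctures.
\<close>

lemma arg_lift_isotopic:
  assumes iso: "isotopic n f g" and \<theta>: "arg_lift (disk n) f \<theta>"
  obtains \<eta> where "arg_lift (disk n) g \<eta>"
    "\<And>k. k \<in> punctures n \<Longrightarrow> g k = f k"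
    "\<And>k l. k \<in> punctures n \<Longrightarrow> l \<in> punctures n \<Longrightarrow> k \<noteq> l \<Longrightarrow> \<eta> (k, l) = \<theta> (k, l)"
proof -
  obtain K where cK: "continuous_map (prod_topology (top_of_set {0..1::real}) (top_of_set (disk n))) (top_of_set (disk n)) K"
      and K': "\<forall>z. K (0, z) = f z" "\<forall>z. K (1, z) = g z"
        "\<forall>t\<in>{0..1}. disk_homeo n (\<lambda>z. K (t, z))"
    using iso unfolding isotopic_def homotopic_with_def by blast
  have K: "continuous_on ({0..1} \<times> disk n) K"
      "\<And>z. K (0, z) = f z" "\<And>z. K (1, z) = g z"
      "\<And>t. t \<in> {0..1} \<Longrightarrow> disk_homeo n (\<lambda>z. K (t, z))"
    using cK K' by (simp_all del: atLeastAtMost_iff)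
  have inj: "inj_on (\<lambda>z. K (t, z)) (disk n)" if t: "t \<in> {0..1}" for t
  proof -
    obtain k where "homeomorphism (disk n) (disk n) (\<lambda>z. K (t, z)) k"
      using K(4)[OF t] unfolding disk_homeo_def by blast
    from homeomorphism_apply1[OF this] show ?thesis by (rule inj_on_inverseI)
  qed
  note sub = punctures_subset_disk[of n]
  have fixed: "K (t, k) = f k" if k: "k \<in> punctures n" and t: "t \<in> {0..1}" for k t
  proof -
    have "(\<lambda>t. K (t, k)) ` {0..1} \<subseteq> punctures n"
    proof (clarify)
      fix s :: real assume "s \<in> {0..1}"
      then have "(\<lambda>z. K (s, z)) ` punctures n = punctures n"
        using K(4) by (simp add: disk_homeo_def)
      then show "K (s, k) \<in> punctures n" using k by blast
    qed
    then have "finite ((\<lambda>t. K (t, k)) ` {0..1})"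
      by (rule finite_subset) (simp add: punctures_def)
    moreover have "continuous_on {0..1} (\<lambda>t. K (t, k))"
      using k sub by (intro continuous_on_compose2[OF K(1), of _ "\<lambda>t. (t, k)"] continuous_intros) auto
    ultimately have "(\<lambda>t. K (t, k)) constant_on {0..1}"
      by (intro continuous_finite_range_constant) auto
    then obtain c where "\<forall>t\<in>{0..1}. K (t, k) = c" unfolding constant_on_def by blast
    from bspec[OF this t] bspec[OF this, of 0] show ?thesis by (simp add: K(2))
  qed
  obtain \<eta> where \<eta>: "arg_lift (disk n) (\<lambda>z. K (1, z)) \<eta>"
    "\<And>x y u. (x, y) \<in> config (disk n) \<Longrightarrow> continuous_on {0..1} u \<Longrightarrow> u 0 = \<theta> (x, y) \<Longrightarrow>
      (\<And>t. t \<in> {0..1} \<Longrightarrow> exp (u t) * (x - y) = K (t, x) - K (t, y)) \<Longrightarrow> \<eta> (x, y) = u 1"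
    using arg_lift_homotopy[OF \<theta> K(2) K(1) inj] by metis
  show ?thesis
  proof
    show "arg_lift (disk n) g \<eta>" using \<eta>(1) K(3) by simp
    show "g k = f k" if "k \<in> punctures n" for k using fixed[OF that, of 1] K(3) by simp
    fix k l assume kl: "k \<in> punctures n" "l \<in> punctures n" "k \<noteq> l"
    show "\<eta> (k, l) = \<theta> (k, l)"
      using kl sub arg_lift_exp[OF \<theta>, of k l] fixed
      by (intro \<eta>(2)[of k l "\<lambda>_. \<theta> (k, l)"]) (auto simp: config_def)
  qed
qed

section \<open>The winding of a braid\<close>

lemma inj_half_twist: "inj (half_twist i s)"
  by (metis half_twist_inverse injI)

lemma half_twist_0: "half_twist i 0 z = z"
  by (simp add: half_twist_def Let_def)

lemma cmod_puncture_minus_centre: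
  "cmod (of_nat k - complex_of_real (real i + 1 / 2)) = \<bar>real k - real i - 1 / 2\<bar>"
proof -
  have "of_nat k - complex_of_real (real i + 1 / 2) = complex_of_real (real k - real i - 1 / 2)"
    by simp
  then show ?thesis by (simp only: norm_of_real)
qed

lemma Re_half_twist_puncture:
  "Re (half_twist i s (of_nat k)) \<in> (if k \<in> {i, Suc i} then {real i..real i + 1} else {real k})"
proof (cases "k \<in> {i, Suc i}")
  case True
  let ?c = "complex_of_real (real i + 1 / 2)"
  have "cmod (of_nat k - ?c) = \<bar>real k - real i - 1 / 2\<bar>" by (rule cmod_puncture_minus_centre)
  also have "\<dots> = 1 / 2" using True by auto
  finally have "cmod (half_twist i s (of_nat k) - ?c) = 1 / 2" by (simp only: norm_half_twist)
  then have "\<bar>Re (half_twist i s (of_nat k) - ?c)\<bar> \<le> 1 / 2" by (metis abs_Re_le_cmod)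
  then have "- (1 / 2) \<le> Re (half_twist i s (of_nat k)) - (real i + 1 / 2)"
      "Re (half_twist i s (of_nat k)) - (real i + 1 / 2) \<le> 1 / 2"
    by (simp_all only: abs_le_iff minus_complex.sel Re_complex_of_real) linarith
  then show ?thesis using True by simp
next
  case False
  have "cmod (of_nat k - complex_of_real (real i + 1 / 2)) = \<bar>real k - real i - 1 / 2\<bar>"
    by (rule cmod_puncture_minus_centre)
  also have "\<dots> \<ge> 1" using False by (cases "k < i") auto
  finally show ?thesis using False by (simp only: half_twist_outside) simp
qed

text \<open>
  A half twist about \<open>i + 1/2\<close> moves \<open>i\<close> and \<open>i + 1\<close> on a circle over the interval from \<open>i\<close> to
  \<open>i + 1\<close>, so at every stage each other puncture stays strictly to the left or to the right of both.
  Their difference keeps to a half plane and gains no argument.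
\<close>

lemma half_twist_keeps_order:
  assumes "p \<noteq> q" "{p, q} \<noteq> {i, Suc i}"
  shows "Re ((half_twist i s (of_nat p) - half_twist i s (of_nat q)) / (of_nat p - of_nat q)) > 0"
proof -
  have less: "Re (half_twist i s (of_nat k)) < Re (half_twist i s (of_nat l))"
    if "k < l" "{k, l} \<noteq> {i, Suc i}" for k l
    using Re_half_twist_puncture[of i s k] Re_half_twist_puncture[of i s l] that
    by (auto split: if_splits simp: doubleton_eq_iff)
  have eq: "of_nat p - of_nat q = complex_of_real (real p - real q)" by simp
  show ?thesis
    unfolding eq Re_divide_of_real
    using less[of p q] less[of q p] assms
    by (cases "p < q") (auto simp: divide_neg_neg insert_commute)
qed

lemma half_twist_swapped:
  assumes "{p, q} = {i, Suc i}"
  shows "half_twist i s (of_nat p) - half_twist i s (of_nat q) = cis (s * pi) * (of_nat p - of_nat q)"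
proof -
  let ?c = "complex_of_real (real i + 1 / 2)"
  have "half_twist i s (of_nat k) = ?c + (of_nat k - ?c) * cis (s * pi)" if "k \<in> {i, Suc i}" for k
  proof -
    have "cmod (of_nat k - ?c) = \<bar>real k - real i - 1 / 2\<bar>" by (rule cmod_puncture_minus_centre)
    also have "\<dots> = 1 / 2" using that by auto
    finally have d: "cmod (of_nat k - ?c) = 1 / 2" .
    show ?thesis unfolding half_twist_def Let_def d by simp
  qed
  moreover have "p \<in> {i, Suc i}" "q \<in> {i, Suc i}" using assms by auto
  ultimately have
    "half_twist i s (of_nat p) - half_twist i s (of_nat q) =
      (?c + (of_nat p - ?c) * cis (s * pi)) - (?c + (of_nat q - ?c) * cis (s * pi))"
    by (simp only:)
  also have "\<dots> = cis (s * pi) * (of_nat p - of_nat q)"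
    by (simp only: algebra_simps)
  finally show ?thesis .
qed

text \<open>
  The twist angle grows from 0 to \<open>s * \<pi>\<close>.  The path of logarithms that starts at 0 is explicit at
  every pair of punctures: linear for the two that are swapped, the principal branch for the others.
\<close>

lemma half_twist_arg_lift:
  assumes s: "s = 1 \<or> s = -1"
  obtains \<theta> where "arg_lift UNIV (half_twist i s) \<theta>"
    "\<And>p q. p \<noteq> q \<Longrightarrow> Im (\<theta> (of_nat p, of_nat q)) = (if {p, q} = {i, Suc i} then s * pi else 0)"
proof -
  define K where "K = (\<lambda>(t, z). half_twist i (t * s) z)"
  have K: "K (t, z) = half_twist i (t * s) z" for t z by (simp add: K_def)
  have cont: "continuous_on A K" for A
    unfolding K_def half_twist_def Let_def case_prod_unfold by (intro continuous_intros)
  have path: "continuous_on A (\<lambda>t. half_twist i (t * s) z)" for A z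
    unfolding half_twist_def Let_def by (intro continuous_intros)
  obtain \<eta> where \<eta>: "arg_lift UNIV (\<lambda>z. K (1, z)) \<eta>"
    "\<And>x y u. (x, y) \<in> config UNIV \<Longrightarrow> continuous_on {0..1} u \<Longrightarrow> u 0 = 0 \<Longrightarrow>
      (\<And>t. t \<in> {0..1} \<Longrightarrow> exp (u t) * (x - y) = K (t, x) - K (t, y)) \<Longrightarrow> \<eta> (x, y) = u 1"
    by (rule arg_lift_homotopy[OF arg_lift_id, of UNIV K])
       (use cont inj_half_twist in \<open>auto simp: K half_twist_0\<close>)
  have "Im (\<eta> (of_nat p, of_nat q)) = (if {p, q} = {i, Suc i} then s * pi else 0)"
    if pq: "p \<noteq> q" for p q
  proof (cases "{p, q} = {i, Suc i}")
    case True
    have "\<eta> (of_nat p, of_nat q) = \<i> * complex_of_real (1 * s * pi)"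
      using pq by (intro \<eta>(2)[of _ _ "\<lambda>t. \<i> * complex_of_real (t * s * pi)"] continuous_intros)
        (simp_all add: config_def K half_twist_swapped[OF True] cis_conv_exp del: of_real_mult)
    then show ?thesis using True by simp
  next
    case False
    define r where "r = (\<lambda>t. (half_twist i (t * s) (of_nat p) - half_twist i (t * s) (of_nat q)) /
        (of_nat p - of_nat q))"
    have pos: "Re (r t) > 0" for t unfolding r_def by (rule half_twist_keeps_order[OF pq False])
    then have nz: "r t \<noteq> 0" "r t \<notin> \<real>\<^sub>\<le>\<^sub>0" for t
      by (metis less_irrefl zero_complex.sel(1), metis complex_nonpos_Reals_iff not_le)
    have "continuous_on {0..1} r"
      unfolding r_def using pq by (intro continuous_intros path) auto
    then have "\<eta> (of_nat p, of_nat q) = Ln (r 1)"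
      using pq nz by (intro \<eta>(2)[of _ _ "\<lambda>t. Ln (r t)"] continuous_intros)
        (auto simp: config_def K r_def half_twist_0)
    moreover have "r 1 \<in> \<real>"
      unfolding r_def using s by (simp add: half_twist_puncture[OF s])
    then have "Im (Ln (r 1)) = 0"
      using pos[of 1] by (metis Im_Ln_eq_0 Reals_cases Im_complex_of_real nz(1))
    ultimately show ?thesis using False by simp
  qed
  then show ?thesis using that \<eta>(1) by (simp add: K)
qed

lemma braid_homeo_snoc:
  "braid_homeo (w @ [(i, e)]) = half_twist i (if e then -1 else 1) \<circ> braid_homeo w"
  by (simp add: braid_homeo_def)

lemma continuous_braid_homeo: "continuous_on A (braid_homeo w)"
proof (induction w arbitrary: A rule: rev_induct)
  case (snoc x w)
  obtain i e where x: "x = (i, e)" by force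
  show ?case unfolding x braid_homeo_snoc
    by (intro continuous_on_compose snoc continuous_half_twist)
qed (simp add: braid_homeo_def)

lemma braid_homeo_strand_at: "braid_homeo w (of_nat (strand_at w p)) = of_nat p"
proof (induction w arbitrary: p rule: rev_induct)
  case (snoc x w)
  obtain i e where x: "x = (i, e)" by force
  show ?case unfolding x braid_homeo_snoc strand_at_snoc
    by (simp add: snoc half_twist_puncture)
qed (simp add: braid_homeo_def)

text \<open>
  Each crossing between two strands turns the vector between them by a half turn, clockwise if its
  sign is positive, no matter which of them is over.
\<close>

proposition braid_homeo_arg_lift:
  obtains \<theta> where "arg_lift UNIV (braid_homeo w) \<theta>"
    "\<And>p q. p \<noteq> q \<Longrightarrow> Im (\<theta> (of_nat p, of_nat q)) =
      - pi * of_int (word_crossing_matrix w p q + word_crossing_matrix w q p)"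
proof -
  have "\<exists>\<theta>. arg_lift UNIV (braid_homeo w) \<theta> \<and> (\<forall>p q. p \<noteq> q \<longrightarrow> Im (\<theta> (of_nat p, of_nat q)) =
      - pi * of_int (word_crossing_matrix w p q + word_crossing_matrix w q p))"
  proof (induction w rule: rev_induct)
    case Nil
    show ?case
      using arg_lift_id[of UNIV] by (intro exI[of _ "\<lambda>_. 0"]) (simp add: braid_homeo_def flip: id_def)
  next
    case (snoc x w)
    obtain i e where x: "x = (i, e)" by force
    let ?s = "if e then -1 else 1 :: real"
    obtain \<theta> where \<theta>: "arg_lift UNIV (braid_homeo w) \<theta>"
      "\<And>p q. p \<noteq> q \<Longrightarrow> Im (\<theta> (of_nat p, of_nat q)) =
        - pi * of_int (word_crossing_matrix w p q + word_crossing_matrix w q p)"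
      using snoc by blast
    obtain \<eta> where \<eta>: "arg_lift UNIV (half_twist i ?s) \<eta>"
      "\<And>p q. p \<noteq> q \<Longrightarrow> Im (\<eta> (of_nat p, of_nat q)) = (if {p, q} = {i, Suc i} then ?s * pi else 0)"
      by (rule half_twist_arg_lift[of ?s i]) auto
    let ?f = "braid_homeo w"
    let ?\<theta> = "\<lambda>(x, y). \<theta> (x, y) + \<eta> (?f x, ?f y)"
    have "arg_lift UNIV (braid_homeo (w @ [x])) ?\<theta>"
      unfolding x braid_homeo_snoc
      by (rule arg_lift_compose[OF \<theta>(1) continuous_braid_homeo _ \<eta>(1)]) simp
    moreover have "Im (?\<theta> (of_nat p, of_nat q)) =
        - pi * of_int (word_crossing_matrix (w @ [x]) p q + word_crossing_matrix (w @ [x]) q p)"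
      if pq: "p \<noteq> q" for p q
    proof -
      obtain k l where kl: "p = strand_at w k" "q = strand_at w l"
        using surj_strand_at by (metis surjD)
      \<comment> \<open>The last letter sees the strands at their current positions \<open>k\<close> and \<open>l\<close>.\<close>
      have "k \<noteq> l" using pq kl by auto
      have "word_crossing_matrix [x] k l + word_crossing_matrix [x] l k =
          (if {k, l} = {i, Suc i} then if e then 1 else - 1 else 0)"
        using \<open>k \<noteq> l\<close> by (auto simp: x word_crossing_matrix_Cons doubleton_eq_iff)
      then have "Im (\<eta> (of_nat k, of_nat l)) =
          - pi * of_int (word_crossing_matrix [x] k l + word_crossing_matrix [x] l k)"
        using \<eta>(2)[OF \<open>k \<noteq> l\<close>] by simp
      then show ?thesis
        using \<theta>(2)[OF pq] unfolding kl word_crossing_matrix_append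
        by (simp add: braid_homeo_strand_at algebra_simps)
    qed
    ultimately show ?case by blast
  qed
  then show ?thesis using that by blast
qed


section \<open>Homeomorphisms and the two sides of a curve\<close>

lemma connected_unbounded_subset_outside:
  assumes "connected U" "\<not> bounded U" "U \<inter> S = {}"
  shows "U \<subseteq> outside S"
proof
  fix x assume "x \<in> U"
  then have "U \<subseteq> connected_component_set (- S) x"
    using assms by (intro connected_component_maximal) auto
  then have "\<not> bounded (connected_component_set (- S) x)"
    using assms(2) bounded_subset by blast
  then show "x \<in> outside S" by (simp add: outside)
qed

text \<open>
  The image of the outside is connected and misses \<open>f ` S\<close>.  It is unbounded, since otherwise \<open>g\<close>
  would map its compact closure to a bounded set that contains the outside of \<open>S\<close>.
\<close>

lemma image_outside_subset:
  fixes S :: "complex set" and f g :: "complex \<Rightarrow> complex"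
  assumes f: "homeomorphism UNIV UNIV f g" and S: "compact S"
  shows "f ` outside S \<subseteq> outside (f ` S)"
proof (rule connected_unbounded_subset_outside)
  have cont: "continuous_on A f" "continuous_on A g" for A
    using f continuous_on_subset[OF _ subset_UNIV] by (auto simp: homeomorphism_def)
  have inv: "g (f z) = z" for z using f by (auto simp: homeomorphism_def)
  show "connected (f ` outside S)"
    using S cont by (intro connected_continuous_image connected_outside compact_imp_bounded) auto
  show "\<not> bounded (f ` outside S)"
  proof
    assume "bounded (f ` outside S)"
    then have "compact (g ` closure (f ` outside S))"
      using cont by (intro compact_continuous_image) auto
    then have "bounded (g ` f ` outside S)"
      by (meson bounded_subset closure_subset compact_imp_bounded image_mono)
    then show False
      using unbounded_outside[OF compact_imp_bounded[OF S]] by (simp add: image_image inv)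
  qed
  show "f ` outside S \<inter> f ` S = {}"
    by (simp flip: image_Int[OF inj_on_inverseI[of UNIV g f, OF inv]])
qed

lemma image_inside:
  fixes S :: "complex set" and f g :: "complex \<Rightarrow> complex"
  assumes f: "homeomorphism UNIV UNIV f g" and S: "compact S"
  shows "f ` inside S = inside (f ` S)"
proof -
  have cont: "continuous_on A f" for A
    using f continuous_on_subset[OF _ subset_UNIV] by (auto simp: homeomorphism_def)
  have inv: "g (f z) = z" "f (g z) = z" for z using f by (auto simp: homeomorphism_def)
  have bij: "bij f" using inv by (metis bijI')
  have "g ` outside (f ` S) \<subseteq> outside (g ` f ` S)"
    using S cont homeomorphism_symD[OF f] by (intro image_outside_subset compact_continuous_image)
  then have "g ` outside (f ` S) \<subseteq> outside S" by (simp add: image_image inv(1))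
  from image_mono[OF this, of f] have "outside (f ` S) \<subseteq> f ` outside S"
    by (simp add: image_image inv(2))
  then have "f ` outside S = outside (f ` S)" using image_outside_subset[OF f S] by blast
  then show ?thesis
    by (simp only: inside_outside bij_image_Compl_eq[OF bij] image_Un)
qed

text \<open>
  The extension by the identity is continuous because the boundary circle is fixed.  It makes
  statements about insides and outsides in the whole plane applicable to \<open>h\<close>.
\<close>

lemma disk_homeo_extend:
  assumes "disk_homeo n h"
  obtains f g where "homeomorphism UNIV UNIV f g" "\<And>z. z \<in> disk n \<Longrightarrow> f z = h z"
proof -
  obtain k where k: "homeomorphism (disk n) (disk n) h k" and fr: "\<And>z. z \<in> frontier (disk n) \<Longrightarrow> h z = z"
    using assms by (auto simp: disk_homeo_def)
  have cl: "closed (disk n)" by (simp add: disk_def)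
  have kfr: "k z = z" if "z \<in> frontier (disk n)" for z
  proof -
    have "z \<in> disk n" using that cl frontier_subset_closed by blast
    then show ?thesis using fr[OF that] k by (metis homeomorphism_apply1)
  qed
  have ext: "continuous_on UNIV (\<lambda>z. if z \<in> disk n then u z else z)"
    if "continuous_on (disk n) u" "\<And>z. z \<in> frontier (disk n) \<Longrightarrow> u z = z" for u
  proof -
    have "continuous_on (disk n \<union> - interior (disk n)) (\<lambda>z. if z \<in> disk n then u z else z)"
      using that cl by (intro continuous_on_cases continuous_on_id) (auto simp: frontier_def)
    moreover have "disk n \<union> - interior (disk n) = UNIV" using interior_subset by blast
    ultimately show ?thesis by simp
  qed
  show ?thesis
  proof
    show "homeomorphism UNIV UNIV (\<lambda>z. if z \<in> disk n then h z else z) (\<lambda>z. if z \<in> disk n then k z else z)"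
      using k fr kfr by (intro homeomorphismI ext) (auto simp: homeomorphism_def)
  qed simp
qed

text \<open>
  If \<open>c\<close> lies inside \<open>d\<close>, then \<open>d\<close> with its outside is a connected unbounded set that avoids \<open>c\<close>, so
  it is outside \<open>c\<close>.  If \<open>c\<close> lies outside \<open>d\<close>, then \<open>d\<close> with its inside is a connected set that
  avoids \<open>c\<close>, and \<open>p\<close> shows on which side of \<open>c\<close> it is.
\<close>

lemma disjoint_curves_nested:
  fixes c d :: "real \<Rightarrow> complex"
  assumes c: "simple_path c" "pathfinish c = pathstart c"
    and d: "simple_path d" "pathfinish d = pathstart d"
    and disj: "path_image c \<inter> path_image d = {}"
    and p: "p \<in> inside (path_image c)" "p \<in> inside (path_image d)"
  shows "inside (path_image c) \<subseteq> inside (path_image d) \<or> inside (path_image d) \<subseteq> inside (path_image c)"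
proof -
  let ?C = "path_image c" and ?D = "path_image d"
  note jc = Jordan_inside_outside[OF c] and jd = Jordan_inside_outside[OF d]
  have "connected ?C" using c(1) by (simp add: connected_simple_path_image)
  moreover have "?C \<subseteq> inside ?D \<union> outside ?D" using disj jd by auto
  ultimately consider "?C \<subseteq> inside ?D" | "?C \<subseteq> outside ?D"
    using connectedD[of ?C "inside ?D" "outside ?D"] jd by blast
  then show ?thesis
  proof cases
    case 1
    have "?D \<union> outside ?D \<subseteq> outside ?C"
    proof (rule connected_unbounded_subset_outside)
      have "closure (outside ?D) = ?D \<union> outside ?D"
        using jd closure_Un_frontier[of "outside ?D"] by auto
      then show "connected (?D \<union> outside ?D)" using jd by (metis connected_imp_connected_closure)
      show "\<not> bounded (?D \<union> outside ?D)" using jd bounded_subset by blast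
      show "(?D \<union> outside ?D) \<inter> ?C = {}" using 1 disj jd by blast
    qed
    then have "inside ?C \<subseteq> inside ?D"
      using inside_Int_outside[of ?C] by (subst inside_outside[of ?D]) blast
    then show ?thesis ..
  next
    case 2
    have "closure (inside ?D) = ?D \<union> inside ?D"
      using jd closure_Un_frontier[of "inside ?D"] by auto
    then have "connected (?D \<union> inside ?D)" using jd by (metis connected_imp_connected_closure)
    moreover have "?D \<union> inside ?D \<subseteq> inside ?C \<union> outside ?C"
      using 2 disj inside_Int_outside[of ?D] unfolding inside_Un_outside by blast
    moreover have "open (inside ?C)" "open (outside ?C)" using jc by auto
    moreover have "inside ?C \<inter> outside ?C \<inter> (?D \<union> inside ?D) = {}" by simp
    moreover have "inside ?C \<inter> (?D \<union> inside ?D) \<noteq> {}" using p by blast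
    ultimately have "outside ?C \<inter> (?D \<union> inside ?D) = {}" by (metis connectedD)
    then have "?D \<union> inside ?D \<subseteq> inside ?C"
      using \<open>?D \<union> inside ?D \<subseteq> inside ?C \<union> outside ?C\<close> by blast
    then show ?thesis by blast
  qed
qed

section \<open>Reducible pure braids\<close>

text \<open>
  Seen from \<open>k\<close>, the argument has a continuous branch on \<open>J\<close>, which measures the turning of the
  vector from \<open>y\<close> to \<open>k\<close> under \<open>h\<close> by its values at \<open>y\<close> and \<open>h y\<close>.  It differs from \<open>\<theta>\<close> by a constant
  on \<open>I\<close>, and at a fixed point of \<open>h\<close> it measures no turning.
\<close>

lemma arg_lift_eq_on_region:
  assumes lift: "arg_lift D h \<theta>" and h: "continuous_on D h"
    and I: "connected I" "I \<subseteq> D" "I \<subseteq> J" "h ` I \<subseteq> J" and J: "open J" "simply_connected J"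
    and k: "k \<in> D" "k \<notin> J" "h k = k"
    and l: "l \<in> I" "h l = l" and l': "l' \<in> I" "h l' = l'"
  shows "\<theta> (k, l) = \<theta> (k, l')"
proof -
  have "continuous_on J (\<lambda>z. k - z)" "\<forall>z\<in>J. k - z \<noteq> 0"
    using k by (auto intro!: continuous_intros)
  then obtain L where L: "continuous_on J L" "\<And>z. z \<in> J \<Longrightarrow> k - z = exp (L z)"
    using J simply_connected_eq_continuous_log[OF J(1)] by metis
  define \<psi> where "\<psi> = (\<lambda>y. \<theta> (k, y) + L y - L (h y))"
  have "\<psi> l' = \<psi> l"
  proof (rule continuous_log_unique[of I \<psi> "\<lambda>_. \<psi> l" l l'])
    have "continuous_on I (\<lambda>y. \<theta> (k, y))"
      using lift I k unfolding arg_lift_def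
      by (intro continuous_on_compose2[of "config D" \<theta> _ "\<lambda>y. (k, y)"] continuous_intros) (auto simp: config_def)
    moreover have "continuous_on I L" by (rule continuous_on_subset[OF L(1) I(3)])
    moreover have "continuous_on I (\<lambda>y. L (h y))"
      by (rule continuous_on_compose2[OF L(1) continuous_on_subset[OF h I(2)] I(4)])
    ultimately show "continuous_on I \<psi>" unfolding \<psi>_def by (intro continuous_intros)
    have one: "exp (\<psi> y) = 1" if "y \<in> I" for y
    proof -
      have y: "y \<in> D" "y \<in> J" "h y \<in> J" "k \<noteq> y" using that I k by auto
      have "exp (\<theta> (k, y)) * exp (L y) = exp (L (h y))"
        using arg_lift_exp[OF lift k(1) y(1,4)] k(3) L(2)[OF y(2)] L(2)[OF y(3)] by simp
      then show ?thesis by (simp add: \<psi>_def exp_add exp_diff)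
    qed
    show "exp (\<psi> y) = exp (\<psi> l)" if "y \<in> I" for y using one[OF that] one[OF l(1)] by simp
  qed (use I l l' in auto)
  then show ?thesis using l l' by (simp add: \<psi>_def)
qed

text \<open>
  The curves \<open>C\<close> and \<open>h ` C\<close> may differ even though they enclose the same punctures: a reduction system
  can contain parallel curves.  The larger of the two insides serves as the region \<open>J\<close> above.
\<close>

lemma reduction_curve_arg_lift:
  assumes h: "disk_homeo n h" and fixed: "\<And>k. k \<in> punctures n \<Longrightarrow> h k = k"
    and lift: "arg_lift (disk n) h \<theta>"
    and sys: "reduction_system n \<C>" and perm: "(`) h ` \<C> = \<C>" and C: "C \<in> \<C>"
    and k: "k \<in> punctures n" "k \<notin> inside C"
    and l: "l \<in> punctures n" "l \<in> inside C" and l': "l' \<in> punctures n" "l' \<in> inside C"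
  shows "\<theta> (k, l) = \<theta> (k, l')"
proof -
  have hC: "h ` C \<in> \<C>" using C perm by blast
  have curve: "curve_in_punctured_disk n A" if "A \<in> \<C>" for A
    using sys that by (simp add: reduction_system_def)
  obtain c where c: "simple_path c" "pathfinish c = pathstart c" "path_image c = C"
    using curve[OF C] unfolding curve_in_punctured_disk_def by blast
  obtain d where d: "simple_path d" "pathfinish d = pathstart d" "path_image d = h ` C"
    using curve[OF hC] unfolding curve_in_punctured_disk_def by blast
  have sub: "C \<subseteq> interior (disk n)"
    using curve[OF C] unfolding curve_in_punctured_disk_def by blast
  then have C_disk: "C \<subseteq> disk n" using interior_subset by blast
  have in_disk: "inside C \<subseteq> disk n"
  proof -
    have "convex (disk n)" by (simp add: disk_def)
    then show ?thesis using outside_subset_convex[OF _ C_disk] inside_Int_outside[of C] by blast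
  qed
  obtain f g where f: "homeomorphism UNIV UNIV f g" "\<And>z. z \<in> disk n \<Longrightarrow> f z = h z"
    using disk_homeo_extend[OF h] by blast
  have "compact C" using c compact_simple_path_image by blast
  moreover have "f ` inside C = h ` inside C" "f ` C = h ` C"
    using f(2) in_disk C_disk by (auto intro!: image_cong)
  ultimately have h_inside: "h ` inside C = inside (h ` C)" using image_inside[OF f(1)] by metis
  have cont: "continuous_on (disk n) h" using h by (auto simp: disk_homeo_def homeomorphism_def)
  have k_disk: "k \<in> disk n" using k(1) punctures_subset_disk by blast
  have k': "k \<notin> inside (h ` C)"
  proof
    assume "k \<in> inside (h ` C)"
    then obtain z where z: "z \<in> inside C" "h z = k" by (metis h_inside imageE)
    then have "z = k"
      using fixed[OF k(1)] k_disk in_disk arg_lift_imp_inj[OF lift] by (metis inj_onD subsetD)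
    then show False using z k(2) by simp
  qed
  have l_in: "l \<in> inside (h ` C)" using l fixed h_inside by (metis imageI)
  have "inside C \<subseteq> inside (h ` C) \<or> inside (h ` C) \<subseteq> inside C"
  proof (cases "h ` C = C")
    case False
    then have "C \<inter> h ` C = {}"
      using sys C hC by (auto simp: reduction_system_def pairwise_def disjnt_def)
    then show ?thesis
      using disjoint_curves_nested[OF c(1,2) d(1,2), of l] l l_in by (simp add: c(3) d(3))
  qed simp
  moreover have "open (inside C)" "connected (inside C)" "open (inside (h ` C))"
    using Jordan_inside_outside[OF c(1,2)] Jordan_inside_outside[OF d(1,2)] by (simp_all add: c(3) d(3))
  moreover have "simply_connected (inside C)" "simply_connected (inside (h ` C))"
    using simply_connected_inside_simple_path[OF c(1)] simply_connected_inside_simple_path[OF d(1)]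
    by (simp_all add: c(3) d(3))
  ultimately obtain J where J: "open J" "simply_connected J" "inside C \<subseteq> J" "h ` inside C \<subseteq> J" "k \<notin> J"
    using k(2) k' h_inside by (metis subset_refl)
  show ?thesis
    by (rule arg_lift_eq_on_region[OF lift cont _ in_disk J(3,4,1,2) k_disk J(5)])
       (use fixed k l l' \<open>connected (inside C)\<close> in auto)
qed

proposition reducible_crossing_matrix:
  assumes red: "reducible_braid n b" and b: "b \<in> carrier (braid_group n)" "pure_braid n b"
    and sym: "\<forall>i\<in>{1..n}. \<forall>j\<in>{1..n}. crossing_matrix b i j = crossing_matrix b j i"
  obtains S where "S \<subseteq> {1..n}" "2 \<le> card S" "card S < n"
    "\<And>k l l'. k \<in> {1..n} - S \<Longrightarrow> l \<in> S \<Longrightarrow> l' \<in> S \<Longrightarrow> crossing_matrix b k l = crossing_matrix b k l'"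
proof -
  obtain f \<C> g where f: "f \<in> mapping_class n b" and sys: "reduction_system n \<C>"
    and g: "isotopic n id g" "(`) g ` (`) f ` \<C> = \<C>"
    using red by (auto simp: reducible_braid_def isotopic_families_def)
  obtain w where w: "w \<in> b" "isotopic n (braid_homeo w) f"
    using f by (auto simp: mapping_class_def)
  obtain w0 where w0: "w0 \<in> braid_words n" "b = braid_rel n `` {w0}"
    using b(1) by (rule braid_group_cases)
  have ww: "w \<in> braid_words n" using w w0 by (auto simp: braid_rel_def dest: braid_eq_words)
  have bw: "b = braid_rel n `` {w}"
    using w w0 ww by (simp add: braid_class_eq_iff) (simp add: braid_rel_def)
  have cm: "crossing_matrix b x y = word_crossing_matrix w x y" for x y
    unfolding bw by (rule crossing_matrix_class[OF ww])
  have sw: "strand_at w = id" using b(2) ww unfolding bw by (simp add: pure_braid_iff_strand_id)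
  have homeo: "disk_homeo n f" "disk_homeo n g"
    using w(2) g(1) homotopic_with_imp_property unfolding isotopic_def by blast+
  obtain \<theta>0 where \<theta>0: "arg_lift UNIV (braid_homeo w) \<theta>0"
    "\<And>p q. p \<noteq> q \<Longrightarrow> Im (\<theta>0 (of_nat p, of_nat q)) =
      - pi * of_int (word_crossing_matrix w p q + word_crossing_matrix w q p)"
    using braid_homeo_arg_lift[of w] by blast
  obtain \<theta>1 where \<theta>1: "arg_lift (disk n) f \<theta>1" "\<And>k. k \<in> punctures n \<Longrightarrow> f k = braid_homeo w k"
    "\<And>k l. k \<in> punctures n \<Longrightarrow> l \<in> punctures n \<Longrightarrow> k \<noteq> l \<Longrightarrow> \<theta>1 (k, l) = \<theta>0 (k, l)"
    using arg_lift_isotopic[OF w(2) arg_lift_subset[OF \<theta>0(1) subset_UNIV]] by metis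
  obtain \<theta>2 where \<theta>2: "arg_lift (disk n) g \<theta>2" "\<And>k. k \<in> punctures n \<Longrightarrow> g k = k"
    "\<And>k l. k \<in> punctures n \<Longrightarrow> l \<in> punctures n \<Longrightarrow> k \<noteq> l \<Longrightarrow> \<theta>2 (k, l) = 0"
    using arg_lift_isotopic[OF g(1) arg_lift_id] by (metis id_apply)
  have f_fixed: "f k = k" if "k \<in> punctures n" for k
    using that \<theta>1(2)[OF that] braid_homeo_strand_at[of w] sw by (auto simp: punctures_def)
  \<comment> \<open>The ambient isotopy \<open>g\<close> fixes the punctures and adds nothing to the lift there, so \<open>g \<circ> f\<close>
    permutes the curves themselves and keeps the winding numbers of the braid.\<close>
  let ?h = "g \<circ> f" and ?\<theta> = "\<lambda>(x, y). \<theta>1 (x, y) + \<theta>2 (f x, f y)"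
  have fd: "continuous_on (disk n) f" "f ` disk n \<subseteq> disk n"
    using homeo(1) by (auto simp: disk_homeo_def homeomorphism_def)
  have lift: "arg_lift (disk n) ?h ?\<theta>" by (rule arg_lift_compose[OF \<theta>1(1) fd \<theta>2(1)])
  have h: "disk_homeo n ?h"
  proof -
    obtain f' g' where "homeomorphism (disk n) (disk n) f f'" "homeomorphism (disk n) (disk n) g g'"
      using homeo by (auto simp: disk_homeo_def)
    then have "homeomorphism (disk n) (disk n) ?h (f' \<circ> g')" by (rule homeomorphism_compose)
    moreover have "\<forall>z\<in>frontier (disk n). ?h z = z" using homeo by (simp add: disk_homeo_def)
    moreover have "?h ` punctures n = punctures n" by (simp add: f_fixed \<theta>2(2))
    ultimately show ?thesis by (auto simp: disk_homeo_def)
  qed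
  have fixed: "?h k = k" if "k \<in> punctures n" for k
    using that by (simp add: f_fixed \<theta>2(2))
  have perm: "(`) ?h ` \<C> = \<C>" using g(2) by (simp add: image_image image_comp)
  have \<theta>: "Im (?\<theta> (of_nat p, of_nat q)) = - 2 * pi * of_int (crossing_matrix b p q)"
    if "p \<in> {1..n}" "q \<in> {1..n}" "p \<noteq> q" for p q
  proof -
    have pq: "of_nat p \<in> punctures n" "of_nat q \<in> punctures n" "complex_of_nat p \<noteq> of_nat q"
      using that by (auto simp: punctures_def)
    have "Im (?\<theta> (of_nat p, of_nat q)) =
        - pi * of_int (word_crossing_matrix w p q + word_crossing_matrix w q p)"
      using \<theta>1(3)[OF pq] \<theta>2(3)[OF pq] \<theta>0(2)[OF that(3)] f_fixed pq by simp
    also have "word_crossing_matrix w q p = word_crossing_matrix w p q"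
      using sym that by (simp add: cm)
    finally show ?thesis by (simp add: cm)
  qed
  obtain C where C: "C \<in> \<C>" using sys by (auto simp: reduction_system_def)
  define S where "S = {k \<in> {1..n}. complex_of_nat k \<in> inside C}"
  have "of_nat ` S = inside C \<inter> punctures n" by (auto simp: S_def punctures_def)
  then have card: "card S = card (inside C \<inter> punctures n)"
    by (metis card_image inj_on_of_nat)
  show ?thesis
  proof
    show "S \<subseteq> {1..n}" by (auto simp: S_def)
    show "2 \<le> card S" "card S < n" using sys C by (auto simp: card reduction_system_def)
    fix k l l' assume k: "k \<in> {1..n} - S" and l: "l \<in> S" and l': "l' \<in> S"
    then have "?\<theta> (of_nat k, of_nat l) = ?\<theta> (of_nat k, of_nat l')"
      by (intro reduction_curve_arg_lift[OF h fixed lift sys perm C]) (auto simp: S_def punctures_def)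
    moreover have "k \<in> {1..n}" "l \<in> {1..n}" "k \<noteq> l" "l' \<in> {1..n}" "k \<noteq> l'"
      using k l l' by (auto simp: S_def)
    ultimately show "crossing_matrix b k l = crossing_matrix b k l'"
      using \<theta>[of k l] \<theta>[of k l'] by simp
  qed
qed

lemma separating_matrix_pseudo_anosov:
  fixes n :: nat and a :: "nat \<Rightarrow> nat \<Rightarrow> int"
  assumes n: "n \<ge> 3"
    and diag: "\<forall>i\<in>{1..n}. a i i = 0"
    and sym: "\<forall>i\<in>{1..n}. \<forall>j\<in>{1..n}. a i j = a j i"
    and sep: "\<And>S k l l'. S \<subseteq> {1..n} \<Longrightarrow> 1 < card S \<Longrightarrow> card S < n \<Longrightarrow>
      k \<in> {1..n} - S \<Longrightarrow> l \<in> S \<Longrightarrow> l' \<in> S \<Longrightarrow> l \<noteq> l' \<Longrightarrow> a k l \<noteq> a k l'"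
  shows "\<exists>b\<in>carrier (braid_group n). pure_braid n b \<and> pseudo_anosov_braid n b \<and>
    (\<forall>i\<in>{1..n}. \<forall>j\<in>{1..n}. crossing_matrix b i j = a i j)"
proof -
  obtain w where w: "w \<in> braid_words n" "strand_at w = id"
    "\<And>i j. i \<in> {1..n} \<Longrightarrow> j \<in> {1..n} \<Longrightarrow> word_crossing_matrix w i j = a i j"
    using symmetric_matrix_realised[OF diag sym] by metis
  define b where "b = braid_rel n `` {w}"
  have b: "b \<in> carrier (braid_group n)" "pure_braid n b"
    using w by (simp_all add: b_def pure_braid_iff_strand_id)
  have cm: "crossing_matrix b i j = a i j" if "i \<in> {1..n}" "j \<in> {1..n}" for i j
    using that w by (simp add: b_def crossing_matrix_class)
  have "\<not> periodic_braid n b"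
  proof
    assume "periodic_braid n b"
    then have "crossing_matrix b 3 1 = crossing_matrix b 3 2"
      using n by (intro periodic_crossing_matrix_constant[OF b]) auto
    moreover have "a 3 1 \<noteq> a 3 2" using n by (intro sep[of "{1, 2}"]) auto
    ultimately show False using n by (simp add: cm)
  qed
  moreover have "\<not> reducible_braid n b"
  proof
    assume "reducible_braid n b"
    then obtain S where S: "S \<subseteq> {1..n}" "2 \<le> card S" "card S < n"
      "\<And>k l l'. k \<in> {1..n} - S \<Longrightarrow> l \<in> S \<Longrightarrow> l' \<in> S \<Longrightarrow> crossing_matrix b k l = crossing_matrix b k l'"
      using reducible_crossing_matrix[OF _ b] sym cm by metis
    obtain l l' where l: "l \<in> S" "l' \<in> S" "l \<noteq> l'"
      using S(2) by (metis card_2_iff' card_le_Suc0_iff_eq finite_subset[OF S(1)] finite_atLeastAtMost not_less_eq_eq numeral_2_eq_2)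
    have "S \<noteq> {1..n}" using S(3) by auto
    then obtain k where k: "k \<in> {1..n} - S" using S(1) by blast
    have "a k l = a k l'" using S(4)[OF k l(1,2)] S(1) k l by (metis cm DiffD1 subsetD)
    then show False using sep[OF S(1) _ S(3) k l] S(2) by simp
  qed
  ultimately show ?thesis using b cm by (auto simp: pseudo_anosov_braid_def)
qed

theorem corollary2:
  fixes n :: nat and a :: "nat \<Rightarrow> nat \<Rightarrow> int"
  assumes "n \<ge> 3"
    and "\<forall>i\<in>{1..n}. a i i = 0"
    and "\<forall>i\<in>{1..n}. \<forall>j\<in>{1..n}. a i j = a j i"
  shows "((\<forall>S. S \<subseteq> {1..n} \<and> 1 < card S \<and> card S < n \<longrightarrow>
            (\<forall>k\<in>{1..n} - S. \<forall>l\<in>S. \<forall>l'\<in>S. l \<noteq> l' \<longrightarrow> a k l \<noteq> a k l')) \<longrightarrow>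
          (\<exists>b\<in>carrier (braid_group n). pure_braid n b \<and> pseudo_anosov_braid n b \<and>
            (\<forall>i\<in>{1..n}. \<forall>j\<in>{1..n}. crossing_matrix b i j = a i j))) \<and>
         ((\<forall>k\<in>{1..n}. \<forall>l\<in>{1..n}. \<forall>l'\<in>{1..n}. l \<noteq> l' \<longrightarrow> a k l \<noteq> a k l') \<longrightarrow>
          (\<exists>b\<in>carrier (braid_group n). pure_braid n b \<and> pseudo_anosov_braid n b \<and>
            (\<forall>i\<in>{1..n}. \<forall>j\<in>{1..n}. crossing_matrix b i j = a i j)))"
proof (intro conjI impI)
  assume "\<forall>S. S \<subseteq> {1..n} \<and> 1 < card S \<and> card S < n \<longrightarrow>
    (\<forall>k\<in>{1..n} - S. \<forall>l\<in>S. \<forall>l'\<in>S. l \<noteq> l' \<longrightarrow> a k l \<noteq> a k l')"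
  then show "\<exists>b\<in>carrier (braid_group n). pure_braid n b \<and> pseudo_anosov_braid n b \<and>
      (\<forall>i\<in>{1..n}. \<forall>j\<in>{1..n}. crossing_matrix b i j = a i j)"
    by (intro separating_matrix_pseudo_anosov[OF assms]) blast
next
  assume "\<forall>k\<in>{1..n}. \<forall>l\<in>{1..n}. \<forall>l'\<in>{1..n}. l \<noteq> l' \<longrightarrow> a k l \<noteq> a k l'"
  then show "\<exists>b\<in>carrier (braid_group n). pure_braid n b \<and> pseudo_anosov_braid n b \<and>
      (\<forall>i\<in>{1..n}. \<forall>j\<in>{1..n}. crossing_matrix b i j = a i j)"
    by (intro separating_matrix_pseudo_anosov[OF assms]) (meson DiffD1 subsetD)
qed

end
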